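(* Let $(\theta_i)_{i\ge 1}$ and $(\kappa_{i,j})_{i,j\ge 1}$ be sequences of non-negative real numbers such that the coagulation kernel satisfies $\Lambda_{i,j}=\theta_i\theta_j+\kappa_{i,j}$ for all $i,j\ge 1$. Assume that $\inf_{i\ge 1}\frac{\theta_i}{i}=B>0$ and that there is $A\ge 0$ such that $\kappa_{i,j}\le A\theta_i\theta_j$ for all $i,j\ge 1$. Let $\omega^{in}=(\omega_i^{in})_{i\ge1}\in Y_0^+$. Then there exists at least one solution $\omega=(\omega_i)_{i\ge1}$ on $[0,+\infty)$ to the discrete Safronov-Dubovskii coagulation equations with initial datum $\omega^{in}$, such that $\omega(t)\in Y_0^+$ for each $t\in[0,+\infty)$ and, for each $t>0$, $$\|\omega(t)\|_1<\infty .$$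
   Context: The coagulation kernel $(\Lambda_{i,j})_{i,j\ge1}$ is non-negative and symmetric: $0\le\Lambda_{i,j}=\Lambda_{j,i}$ for all $i,j\ge 1$. The discrete Safronov-Dubovskii coagulation equations with initial datum $\omega^{in}=(\omega_i^{in})_{i\ge1}$, $\omega_i^{in}\ge0$, are, for $i\ge 1$, $$\frac{d\omega_i(t)}{dt}=\omega_{i-1}(t)\sum_{j=1}^{i-1}j\Lambda_{i-1,j}\omega_j(t)-\omega_i(t)\sum_{j=1}^{i}j\Lambda_{i,j}\omega_j(t)-\sum_{j=i}^{\infty}\Lambda_{i,j}\omega_i(t)\omega_j(t),\qquad \omega_i(0)=\omega_i^{in},$$ where the first term on the right-hand side is $0$ when $i=1$. Solution: for $T\in(0,+\infty]$, a solution on $[0,T)$ is a sequence $\omega=(\omega_i)_{i\ge1}$ of non-negative continuous functions on $[0,T)$ such that, for each $i\ge1$ and $t\in(0,T)$: $\omega_i\in\mathcal{C}([0,T))$, $\sum_{j=1}^\infty\Lambda_{i,j}\omega_j\in L^1(0,t)$, and $$\omega_i(t)=\omega_i^{in}+\int_0^t\Big(\omega_{i-1}(s)\sum_{j=1}^{i-1}j\Lambda_{i-1,j}\omega_j(s)-\omega_i(s)\sum_{j=1}^{i}j\Lambda_{i,j}\omega_j(s)-\sum_{j=i}^{\infty}\Lambda_{i,j}\omega_i(s)\omega_j(s)\Big)ds .$$ For $p\ge0$, $Y_p=\{y=(y_i)_{i\ge1}:\ \|y\|_p:=\sum_{i=1}^\infty i^p|y_i|<\infty\}$ (real sequences) and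 $Y_p^+=\{y\in Y_p:\ y_i\ge0 \text{ for each } i\ge1\}$. *)

theory Defs
  imports "HOL-Analysis.Analysis"
begin

text \<open>
  Sequences indexed by \<open>i \<ge> 1\<close> are functions on \<^typ>\<open>nat\<close> whose value at \<open>0\<close> is irrelevant;
  a sum over \<open>j = 1, 2, \<dots>\<close> is written as a series in \<open>n\<close> with \<open>j = Suc n\<close>.
\<close>

definition coag_kernel :: "(nat \<Rightarrow> nat \<Rightarrow> real) \<Rightarrow> bool" where
  "coag_kernel \<Lambda> \<longleftrightarrow> (\<forall>i\<ge>1. \<forall>j\<ge>1. 0 \<le> \<Lambda> i j \<and> \<Lambda> i j = \<Lambda> j i)"

text \<open>The weighted norm takes the value \<open>\<infinity>\<close> when the series diverges.\<close>

definition Ynorm :: "real \<Rightarrow> (nat \<Rightarrow> real) \<Rightarrow> ennreal" where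
  "Ynorm p y = (\<Sum>n. ennreal (real (Suc n) powr p * \<bar>y (Suc n)\<bar>))"

definition Y :: "real \<Rightarrow> (nat \<Rightarrow> real) set" where
  "Y p = {y. Ynorm p y < \<infinity>}"

definition Yplus :: "real \<Rightarrow> (nat \<Rightarrow> real) set" where
  "Yplus p = {y \<in> Y p. \<forall>i\<ge>1. 0 \<le> y i}"

text \<open>The sum over \<open>j \<ge> i\<close> is a series in \<open>n\<close> with \<open>j = i + n\<close>.\<close>

definition SD_rhs :: "(nat \<Rightarrow> nat \<Rightarrow> real) \<Rightarrow> (nat \<Rightarrow> real) \<Rightarrow> nat \<Rightarrow> real" where
  "SD_rhs \<Lambda> y i =
     (if i = 1 then 0 else y (i - 1) * (\<Sum>j=1..i - 1. real j * \<Lambda> (i - 1) j * y j))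
     - y i * (\<Sum>j=1..i. real j * \<Lambda> i j * y j)
     - (\<Sum>n. \<Lambda> i (i + n) * y i * y (i + n))"

text \<open>
  Membership of the series \<open>\<Sum>\<^sub>j \<Lambda>\<^sub>i\<^sub>j \<omega>\<^sub>j\<close> in \<open>L\<^sup>1(0,t)\<close> contains its finiteness
  almost everywhere. This is stated separately, because \<^const>\<open>suminf\<close> is an unspecified real
  number where a series diverges. Convergence cannot be required at every time: it may
  fail at time \<open>0\<close> if the initial datum is only in \<open>Y\<^sub>0\<close>. The integral in the last
  conjunct then exists, since its integrand is defined almost everywhere and is integrable.
\<close>

definition SD_solution ::
    "(nat \<Rightarrow> nat \<Rightarrow> real) \<Rightarrow> (nat \<Rightarrow> real) \<Rightarrow> ereal \<Rightarrow> (nat \<Rightarrow> real \<Rightarrow> real) \<Rightarrow> bool" where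
  "SD_solution \<Lambda> \<omega>in T \<omega> \<longleftrightarrow>
     0 < T \<and>
     (\<forall>i\<ge>1.
        continuous_on {t. 0 \<le> t \<and> ereal t < T} (\<omega> i) \<and>
        (\<forall>t. 0 \<le> t \<and> ereal t < T \<longrightarrow> 0 \<le> \<omega> i t) \<and>
        (\<forall>t. 0 < t \<and> ereal t < T \<longrightarrow>
           (AE s in lebesgue. 0 < s \<and> s < t \<longrightarrow> summable (\<lambda>n. \<Lambda> i (Suc n) * \<omega> (Suc n) s)) \<and>
           set_integrable lebesgue {0<..<t} (\<lambda>s. \<Sum>n. \<Lambda> i (Suc n) * \<omega> (Suc n) s) \<and>
           \<omega> i t = \<omega>in i + (LINT s:{0..t}|lebesgue. SD_rhs \<Lambda> (\<lambda>j. \<omega> j s) i)))"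

end

theory Submission
  imports Defs "HOL-Complex_Analysis.Great_Picard"
begin

text \<open>
  The solution is a limit of explicit Euler schemes for the system truncated to the sizes
  \<open>1, \<dots>, n\<close>. The estimates all come from one family of test sequences,
  \<open>\<phi>\<^sub>i = min i N\<close>. For a non-negative sequence \<open>y\<close>, testing the right-hand side with \<open>\<phi>\<close>
  gives \<open>\<Sum>\<^sub>i \<Sum>\<^sub>j\<^sub>\<le>\<^sub>i (j (\<phi>\<^sub>i\<^sub>+\<^sub>1 - \<phi>\<^sub>i) - \<phi>\<^sub>j) \<Lambda>\<^sub>i\<^sub>j y\<^sub>i y\<^sub>j\<close>. For \<open>i < N\<close> the two contributions cancel, for
  \<open>i \<ge> N\<close> only the loss remains; since \<open>\<Lambda>\<^sub>i\<^sub>j \<ge> \<theta>\<^sub>i \<theta>\<^sub>j\<close>, the test functional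
  \<open>\<Sum>\<^sub>i min i N \<omega>\<^sub>i\<close> decreases at least at the rate \<open>(N/2) (\<Sum>\<^sub>i\<^sub>\<ge>\<^sub>N \<theta>\<^sub>i \<omega>\<^sub>i)\<^sup>2\<close>
  (\<open>capped_mass_dissipation\<close>). Integrating in time,
  \<open>\<integral>\<^sub>0\<^sup>\<infinity> (\<Sum>\<^sub>i\<^sub>\<ge>\<^sub>N \<theta>\<^sub>i \<omega>\<^sub>i)\<^sup>2 dt \<le> 2 \<Sum>\<^sub>i (min i N / N) \<omega>\<^sub>i(0)\<close>,
  and the right-hand side tends to \<open>0\<close> as \<open>N \<rightarrow> \<infinity>\<close> for every summable initial datum, by
  dominated convergence (\<open>tail_bound_tendsto_0\<close>). Three things follow, uniformly in the
  truncation.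

  \<^item> The loss rate of each component is bounded in \<open>L\<^sup>2\<close> in time, so each component is Hoelder
    continuous with exponent \<open>1/2\<close> up to the step size (\<open>euler_hoelder\<close>), and a subsequence
    converges pointwise to continuous functions.

  \<^item> The part of the series \<open>\<Sum>\<^sub>j \<Lambda>\<^sub>i\<^sub>j \<omega>\<^sub>j\<close> with \<open>j > N\<close> is small in \<open>L\<^sup>1(0,t)\<close>, because
    \<open>\<Lambda>\<^sub>i\<^sub>j \<le> (1 + A) \<theta>\<^sub>i \<theta>\<^sub>j\<close>. So the limit satisfies the equation with the series
    cut off at \<open>N\<close>, up to an error that vanishes as \<open>N \<rightarrow> \<infinity>\<close> (\<open>lim_approximate_equation\<close>),
    and letting \<open>N\<close> grow gives the equation itself.

  \<^item> The total mass \<open>\<Sum>\<^sub>i i \<omega>\<^sub>i\<close> does not increase, and \<open>B\<close> times it is at most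
    \<open>\<Sum>\<^sub>i \<theta>\<^sub>i \<omega>\<^sub>i\<close>. Hence \<open>t B\<^sup>2 (\<Sum>\<^sub>i i \<omega>\<^sub>i(t))\<^sup>2\<close> is bounded by the time integral of
    \<open>(\<Sum>\<^sub>i \<theta>\<^sub>i \<omega>\<^sub>i)\<^sup>2\<close>, and the mass is finite at every positive time even if it is infinite
    initially (\<open>euler_first_moment\<close>).

  Euler's method replaces the existence theory for the truncated differential equations: the
  moment estimates are linear in the increments and so hold for it without error, and a small
  enough step keeps the iterates non-negative.
\<close>

section \<open>Summation over a triangle\<close>

lemma sum_triangle_swap:
  fixes a :: "nat \<Rightarrow> nat \<Rightarrow> real"
  shows "(\<Sum>i=1..n. \<Sum>j=i..n. a i j) = (\<Sum>j=1..n. \<Sum>i=1..j. a i j)"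
proof (induction n)
  case (Suc n)
  have "(\<Sum>i=1..Suc n. \<Sum>j=i..Suc n. a i j) = (\<Sum>i=1..n. (\<Sum>j=i..n. a i j) + a i (Suc n)) + a (Suc n) (Suc n)"
    by (simp add: sum.cl_ivl_Suc)
  then show ?case
    using Suc by (simp add: sum.distrib)
qed simp

lemma sum_power2_le_triangle:
  fixes a :: "nat \<Rightarrow> real"
  assumes "\<And>i. i \<in> {m..n} \<Longrightarrow> 0 \<le> a i"
  shows "(\<Sum>i=m..n. a i)\<^sup>2 \<le> 2 * (\<Sum>i=m..n. \<Sum>j=m..i. a i * a j)"
  using assms
proof (induction n)
  case 0
  then show ?case by (cases "m = 0") (auto simp: power2_eq_square)
next
  case (Suc n)
  show ?case
  proof (cases "m \<le> Suc n")
    case True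
    have IH: "(\<Sum>i=m..n. a i)\<^sup>2 \<le> 2 * (\<Sum>i=m..n. \<Sum>j=m..i. a i * a j)"
      using Suc by auto
    have "(\<Sum>i=m..Suc n. a i)\<^sup>2
        = (\<Sum>i=m..n. a i)\<^sup>2 + 2 * a (Suc n) * (\<Sum>i=m..n. a i) + (a (Suc n))\<^sup>2"
      using True by (simp add: sum.cl_ivl_Suc power2_sum)
    also have "\<dots> \<le> 2 * (\<Sum>i=m..n. \<Sum>j=m..i. a i * a j)
        + 2 * a (Suc n) * (\<Sum>i=m..n. a i) + 2 * (a (Suc n))\<^sup>2"
      using IH zero_le_power2[of "a (Suc n)"] by linarith
    also have "\<dots> = 2 * (\<Sum>i=m..Suc n. \<Sum>j=m..i. a i * a j)"
      using True by (simp add: sum.cl_ivl_Suc sum_distrib_left power2_eq_square algebra_simps)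
    finally show ?thesis .
  qed auto
qed

section \<open>The truncated equations and their moments\<close>

text \<open>
  The hypotheses of the theorem in the form in which the estimates use them: the kernel lies
  between \<open>\<theta>\<^sub>i \<theta>\<^sub>j\<close> and a multiple of it, with \<open>K = 1 + A\<close>.
\<close>

locale coag_data =
  fixes \<Lambda> :: "nat \<Rightarrow> nat \<Rightarrow> real" and \<theta> \<omega>0 :: "nat \<Rightarrow> real" and K B :: real
  assumes Lam_sym: "\<And>i j. 1 \<le> i \<Longrightarrow> 1 \<le> j \<Longrightarrow> \<Lambda> i j = \<Lambda> j i"
    and Lam_lower: "\<And>i j. 1 \<le> i \<Longrightarrow> 1 \<le> j \<Longrightarrow> \<theta> i * \<theta> j \<le> \<Lambda> i j"
    and Lam_upper: "\<And>i j. 1 \<le> i \<Longrightarrow> 1 \<le> j \<Longrightarrow> \<Lambda> i j \<le> K * \<theta> i * \<theta> j"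
    and theta_lower: "\<And>i. 1 \<le> i \<Longrightarrow> B * real i \<le> \<theta> i"
    and B_pos: "0 < B" and K_nonneg: "0 \<le> K"
    and init_nonneg: "\<And>i. 1 \<le> i \<Longrightarrow> 0 \<le> \<omega>0 i"
    and init_summable: "summable (\<lambda>n. \<omega>0 (Suc n))"
begin

lemma theta_nonneg: "1 \<le> i \<Longrightarrow> 0 \<le> \<theta> i"
  using theta_lower[of i] B_pos by (meson less_imp_le mult_nonneg_nonneg of_nat_0_le_iff order_trans)

lemma Lam_nonneg: "1 \<le> i \<Longrightarrow> 1 \<le> j \<Longrightarrow> 0 \<le> \<Lambda> i j"
  using Lam_lower[of i j] theta_nonneg by (meson mult_nonneg_nonneg order_trans)

definition M :: real where "M = (\<Sum>n. \<omega>0 (Suc n))"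

lemma M_nonneg: "0 \<le> M"
  unfolding M_def by (intro suminf_nonneg init_summable init_nonneg) auto

lemma init_sum_le: "(\<Sum>i=1..n. \<omega>0 i) \<le> M"
proof -
  have "(\<Sum>i=1..n. \<omega>0 i) = (\<Sum>k<n. \<omega>0 (Suc k))"
    by (simp add: sum.atLeast1_atMost_eq)
  also have "\<dots> \<le> M" unfolding M_def
    by (intro sum_le_suminf init_summable init_nonneg) auto
  finally show ?thesis .
qed

text \<open>
  \<open>growth y i\<close> is the flux from size \<open>i\<close> to size \<open>i + 1\<close>. In \<open>rate n\<close>, the right-hand side of
  the equation truncated at \<open>n\<close>, only \<open>loss\<close> depends on \<open>n\<close>. The flux from \<open>n\<close> to \<open>n + 1\<close>
  leaves the truncated system, which costs mass and so only helps the upper bounds.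
\<close>

definition growth :: "(nat \<Rightarrow> real) \<Rightarrow> nat \<Rightarrow> real" where
  "growth y i = y i * (\<Sum>j=1..i. real j * \<Lambda> i j * y j)"

definition loss :: "nat \<Rightarrow> (nat \<Rightarrow> real) \<Rightarrow> nat \<Rightarrow> real" where
  "loss n y i = (\<Sum>j=i..n. \<Lambda> i j * y i * y j)"

definition rate :: "nat \<Rightarrow> (nat \<Rightarrow> real) \<Rightarrow> nat \<Rightarrow> real" where
  "rate n y i = growth y (i - 1) - growth y i - loss n y i"

definition theta_tail :: "nat \<Rightarrow> nat \<Rightarrow> (nat \<Rightarrow> real) \<Rightarrow> real" where
  "theta_tail n N y = (\<Sum>i=N..n. \<theta> i * y i)"

definition capped_mass :: "nat \<Rightarrow> nat \<Rightarrow> (nat \<Rightarrow> real) \<Rightarrow> real" where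
  "capped_mass n N y = (\<Sum>i=1..n. real (min i N) * y i)"

lemma growth_0 [simp]: "growth y 0 = 0"
  by (simp add: growth_def)

lemma growth_nonneg: "(\<And>i. i \<ge> 1 \<Longrightarrow> 0 \<le> y i) \<Longrightarrow> 0 \<le> growth y i"
  by (cases "i = 0") (auto simp: growth_def intro!: mult_nonneg_nonneg sum_nonneg Lam_nonneg)

text \<open>
  Summation by parts in the flux terms produces the differences \<open>\<phi> (i + 1) - \<phi> i\<close>, and the symmetry
  of the kernel moves the loss of \<open>i\<close> in collisions with \<open>j \<ge> i\<close> into the triangle \<open>j \<le> i\<close>. It is
  an inequality because the mass that leaves at size \<open>n\<close> is counted as if it were kept.
\<close>

lemma moment_inequality:
  assumes y: "\<And>i. i \<ge> 1 \<Longrightarrow> 0 \<le> y i" and \<phi>: "\<And>i. 0 \<le> \<phi> i"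
  shows "(\<Sum>i=1..n. \<phi> i * rate n y i)
    \<le> (\<Sum>i=1..n. \<Sum>j=1..i. (real j * (\<phi> (i + 1) - \<phi> i) - \<phi> j) * \<Lambda> i j * y i * y j)"
proof -
  have shift: "(\<Sum>i=1..n. \<phi> i * growth y (i - 1)) + \<phi> (n + 1) * growth y n
      = (\<Sum>i=1..n. \<phi> (i + 1) * growth y i)"
    by (induction n) auto
  have "0 \<le> \<phi> (n + 1) * growth y n"
    using \<phi> growth_nonneg[OF y] by simp
  with shift have gain: "(\<Sum>i=1..n. \<phi> i * growth y (i - 1)) \<le> (\<Sum>i=1..n. \<phi> (i + 1) * growth y i)"
    by linarith
  have "(\<Sum>i=1..n. \<phi> i * loss n y i) = (\<Sum>i=1..n. \<Sum>j=i..n. \<phi> i * (\<Lambda> i j * y i * y j))"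
    by (simp add: loss_def sum_distrib_left)
  also have "\<dots> = (\<Sum>j=1..n. \<Sum>i=1..j. \<phi> i * (\<Lambda> i j * y i * y j))"
    by (rule sum_triangle_swap)
  also have "\<dots> = (\<Sum>i=1..n. \<Sum>j=1..i. \<phi> j * \<Lambda> i j * y i * y j)"
    by (intro sum.cong refl) (auto simp: Lam_sym)
  finally have loss: "(\<Sum>i=1..n. \<phi> i * loss n y i) = (\<Sum>i=1..n. \<Sum>j=1..i. \<phi> j * \<Lambda> i j * y i * y j)" .
  have diff: "(\<Sum>i=1..n. \<phi> (i + 1) * growth y i) - (\<Sum>i=1..n. \<phi> i * growth y i)
      = (\<Sum>i=1..n. \<Sum>j=1..i. real j * (\<phi> (i + 1) - \<phi> i) * \<Lambda> i j * y i * y j)"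
    unfolding growth_def sum_subtractf[symmetric] left_diff_distrib[symmetric] sum_distrib_left
    by (intro sum.cong refl) (simp add: mult_ac)
  have "(\<Sum>i=1..n. \<phi> i * rate n y i) = (\<Sum>i=1..n. \<phi> i * growth y (i - 1))
     - (\<Sum>i=1..n. \<phi> i * growth y i) - (\<Sum>i=1..n. \<phi> i * loss n y i)"
    by (simp add: rate_def right_diff_distrib sum_subtractf)
  also have "\<dots> \<le> ((\<Sum>i=1..n. \<phi> (i + 1) * growth y i) - (\<Sum>i=1..n. \<phi> i * growth y i))
      - (\<Sum>i=1..n. \<phi> i * loss n y i)"
    using gain by linarith
  also have "\<dots> = (\<Sum>i=1..n. \<Sum>j=1..i. (real j * (\<phi> (i + 1) - \<phi> i) - \<phi> j) * \<Lambda> i j * y i * y j)"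
    unfolding diff loss by (simp add: left_diff_distrib sum_subtractf)
  finally show ?thesis .
qed

text \<open>
  The weight \<open>min i N\<close> is additive under coagulation below \<open>N\<close>, where gain and loss cancel, and
  constant above, where only loss is left. So dissipation sees exactly the sizes \<open>i \<ge> N\<close>.
  The factor \<open>1/2\<close> is the passage from the triangle \<open>j \<le> i\<close> to the square.
\<close>

lemma capped_mass_dissipation:
  assumes y: "\<And>i. i \<ge> 1 \<Longrightarrow> 0 \<le> y i" and N: "1 \<le> N"
  shows "capped_mass n N (rate n y) \<le> - (real N / 2) * (theta_tail n N y)\<^sup>2"
proof -
  let ?c = "\<lambda>i j. (real j * (real (min (i + 1) N) - real (min i N)) - real (min j N)) * \<Lambda> i j * y i * y j"
  have "capped_mass n N (rate n y) \<le> (\<Sum>i=1..n. \<Sum>j=1..i. ?c i j)"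
    unfolding capped_mass_def by (rule moment_inequality[OF y]) auto
  also have "\<dots> \<le> (\<Sum>i\<in>{N..n}. \<Sum>j=1..i. ?c i j)"
  proof -
    have "(\<Sum>i=1..n. \<Sum>j=1..i. ?c i j) = (\<Sum>i\<in>{1..n}. if i < N then 0 else (\<Sum>j=1..i. ?c i j))"
      by (intro sum.cong refl) (auto simp: min_def intro!: sum.neutral)
    also have "\<dots> = (\<Sum>i\<in>{N..n}. \<Sum>j=1..i. ?c i j)"
      using N by (intro sum.mono_neutral_cong_right) auto
    finally show ?thesis by simp
  qed
  also have "\<dots> \<le> (\<Sum>i\<in>{N..n}. \<Sum>j=N..i. - (real N * ((\<theta> i * y i) * (\<theta> j * y j))))"
  proof (intro sum_mono)
    fix i assume i: "i \<in> {N..n}"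
    have "(\<Sum>j=1..i. ?c i j) \<le> (\<Sum>j\<in>{1..i}. if j < N then 0 else - (real N * ((\<theta> i * y i) * (\<theta> j * y j))))"
    proof (intro sum_mono)
      fix j assume j: "j \<in> {1..i}"
      have eq: "?c i j = - (real (min j N) * (\<Lambda> i j * (y i * y j)))"
        using i by (cases "i = N") (auto simp: min_def)
      have ge0: "0 \<le> y i * y j" using y[of i] y[of j] i j N by auto
      have L: "\<theta> i * \<theta> j * (y i * y j) \<le> \<Lambda> i j * (y i * y j)"
        using i j N by (intro mult_right_mono[OF _ ge0] Lam_lower) auto
      show "?c i j \<le> (if j < N then 0 else - (real N * ((\<theta> i * y i) * (\<theta> j * y j))))"
      proof (cases "j < N")
        case True
        then show ?thesis
          unfolding eq using ge0 Lam_nonneg[of i j] i j N by auto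
      next
        case False
        have "real N * (\<theta> i * \<theta> j * (y i * y j)) \<le> real N * (\<Lambda> i j * (y i * y j))"
          by (intro mult_left_mono L) auto
        then show ?thesis
          unfolding eq using False by (simp add: mult_ac)
      qed
    qed
    also have "\<dots> = (\<Sum>j=N..i. - (real N * ((\<theta> i * y i) * (\<theta> j * y j))))"
      using N by (intro sum.mono_neutral_cong_right) auto
    finally show "(\<Sum>j=1..i. ?c i j) \<le> (\<Sum>j=N..i. - (real N * ((\<theta> i * y i) * (\<theta> j * y j))))" .
  qed
  also have "\<dots> = - (real N / 2) * (2 * (\<Sum>i=N..n. \<Sum>j=N..i. (\<theta> i * y i) * (\<theta> j * y j)))"
    by (simp add: sum_negf flip: sum_distrib_left)
  also have "\<dots> \<le> - (real N / 2) * (theta_tail n N y)\<^sup>2"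
    unfolding theta_tail_def
    by (intro mult_left_mono_neg sum_power2_le_triangle mult_nonneg_nonneg theta_nonneg y)
       (use N in auto)
  finally show ?thesis .
qed

section \<open>Estimates for the Euler scheme\<close>

text \<open>
  The last summand of the denominator bounds the relative loss rate of every component as long as
  the total number is at most \<open>M\<close>, so that no component can be driven below zero in one step.
  The summand \<open>real n\<close> makes the step size tend to zero.
\<close>

definition step_size :: "nat \<Rightarrow> real" where
  "step_size n = 1 / (1 + real n + M * (\<Sum>i=1..n. \<Sum>j=1..n. (real j + 1) * \<Lambda> i j))"

lemma step_size_bounds:
  shows step_size_pos: "0 < step_size n" and step_size_le: "step_size n \<le> 1 / (1 + real n)"
    and step_size_stable: "step_size n * (M * (\<Sum>i=1..n. \<Sum>j=1..n. (real j + 1) * \<Lambda> i j)) \<le> 1"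
proof -
  have *: "0 \<le> M * (\<Sum>i=1..n. \<Sum>j=1..n. (real j + 1) * \<Lambda> i j)"
    by (intro mult_nonneg_nonneg M_nonneg sum_nonneg Lam_nonneg) auto
  then show "0 < step_size n" "step_size n \<le> 1 / (1 + real n)"
    "step_size n * (M * (\<Sum>i=1..n. \<Sum>j=1..n. (real j + 1) * \<Lambda> i j)) \<le> 1"
    unfolding step_size_def by (auto simp: divide_simps add_nonneg_nonneg add_pos_nonneg add_nonneg_eq_0_iff)
qed

primrec euler :: "nat \<Rightarrow> nat \<Rightarrow> nat \<Rightarrow> real" where
  "euler n 0 = (\<lambda>i. if i \<in> {1..n} then \<omega>0 i else 0)"
| "euler n (Suc k) = (\<lambda>i. if i \<in> {1..n}
      then euler n k i + step_size n * rate n (euler n k) i else 0)"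

lemma euler_outside: "i \<notin> {1..n} \<Longrightarrow> euler n k i = 0"
  by (cases k) auto

lemma capped_mass_euler_Suc:
  "capped_mass n N (euler n (Suc k))
    = capped_mass n N (euler n k) + step_size n * capped_mass n N (rate n (euler n k))"
proof -
  have "capped_mass n N (euler n (Suc k))
    = (\<Sum>i=1..n. real (min i N) * euler n k i + step_size n * (real (min i N) * rate n (euler n k) i))"
    unfolding capped_mass_def by (intro sum.cong) (auto simp: algebra_simps)
  then show ?thesis
    by (simp add: capped_mass_def sum.distrib sum_distrib_left)
qed

lemma le_capped_mass_1:
  assumes "\<And>i. i \<ge> 1 \<Longrightarrow> 0 \<le> y i" "1 \<le> i" "i \<le> n"
  shows "y i \<le> capped_mass n 1 y"
proof -
  have "y i \<le> (\<Sum>i=1..n. y i)"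
    using assms by (intro member_le_sum) auto
  also have "\<dots> = capped_mass n 1 y"
    unfolding capped_mass_def by (intro sum.cong) (auto simp: min_def)
  finally show ?thesis .
qed

lemma euler_step_nonneg:
  assumes y: "\<And>i. i \<ge> 1 \<Longrightarrow> 0 \<le> y i" and My: "capped_mass n 1 y \<le> M" and i: "1 \<le> i" "i \<le> n"
  shows "0 \<le> y i + step_size n * rate n y i"
proof -
  let ?C = "\<Sum>i=1..n. \<Sum>j=1..n. (real j + 1) * \<Lambda> i j"
  have yM: "y j \<le> M" if "1 \<le> j" "j \<le> n" for j
    using le_capped_mass_1[of y j n, OF _ that] y My by (meson order_trans)
  have "growth y i + loss n y i = y i * ((\<Sum>j=1..i. real j * \<Lambda> i j * y j) + (\<Sum>j=i..n. \<Lambda> i j * y j))"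
    by (simp add: growth_def loss_def sum_distrib_left mult_ac distrib_left)
  also have "\<dots> \<le> y i * ((\<Sum>j=1..n. real j * \<Lambda> i j * y j) + (\<Sum>j=1..n. \<Lambda> i j * y j))"
    using i by (intro mult_left_mono add_mono sum_mono2 mult_nonneg_nonneg Lam_nonneg y) auto
  also have "\<dots> = y i * (\<Sum>j=1..n. (real j + 1) * \<Lambda> i j * y j)"
    by (simp add: sum.distrib distrib_right)
  also have "\<dots> \<le> y i * (\<Sum>j=1..n. (real j + 1) * \<Lambda> i j * M)"
    using i by (intro mult_left_mono sum_mono yM y mult_nonneg_nonneg Lam_nonneg) auto
  also have "\<dots> = y i * (M * (\<Sum>j=1..n. (real j + 1) * \<Lambda> i j))"
    by (simp add: sum_distrib_left sum_distrib_right mult_ac)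
  also have "\<dots> \<le> y i * (M * ?C)"
    using i by (intro mult_left_mono M_nonneg y member_le_sum[where f="\<lambda>i. \<Sum>j=1..n. (real j + 1) * \<Lambda> i j"]
        sum_nonneg mult_nonneg_nonneg Lam_nonneg) auto
  finally have "step_size n * (growth y i + loss n y i) \<le> step_size n * (y i * (M * ?C))"
    using step_size_pos[of n] by (intro mult_left_mono) auto
  also have "\<dots> = y i * (step_size n * (M * ?C))" by simp
  also have "\<dots> \<le> y i * 1"
    using i by (intro mult_left_mono step_size_stable y) auto
  finally have "step_size n * (growth y i + loss n y i) \<le> y i" by simp
  moreover have "0 \<le> step_size n * growth y (i - 1)"
    using step_size_pos[of n] growth_nonneg[OF y] by simp
  ultimately show ?thesis
    by (simp add: rate_def algebra_simps)
qed

lemma capped_mass_1_init: "capped_mass n 1 (euler n 0) \<le> M"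
proof -
  have "capped_mass n 1 (euler n 0) = (\<Sum>i=1..n. \<omega>0 i)"
    unfolding capped_mass_def by (intro sum.cong) (auto simp: min_def)
  then show ?thesis using init_sum_le by simp
qed

text \<open>
  Non-negativity and the bound on the total number have to be propagated together: a step
  preserves non-negativity under the bound, and the total number does not increase at non-negative states.
\<close>

lemma euler_invariant: "(\<forall>i. 0 \<le> euler n k i) \<and> capped_mass n 1 (euler n k) \<le> M"
proof (induction k)
  case 0
  then show ?case
    using capped_mass_1_init[of n] by (auto simp: init_nonneg)
next
  case (Suc k)
  have "0 \<le> euler n (Suc k) i" for i
    using Suc euler_step_nonneg[of "euler n k" n i] by auto
  moreover have "step_size n * capped_mass n 1 (rate n (euler n k)) \<le> step_size n * (- (real 1 / 2) * (theta_tail n 1 (euler n k))\<^sup>2)"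
    using step_size_pos[of n] Suc by (intro mult_left_mono capped_mass_dissipation) auto
  then have "capped_mass n 1 (euler n (Suc k)) \<le> capped_mass n 1 (euler n k)"
    unfolding capped_mass_euler_Suc
    using mult_nonneg_nonneg[OF less_imp_le[OF step_size_pos[of n]] zero_le_power2[of "theta_tail n 1 (euler n k)"]]
    by simp
  ultimately show ?case using Suc by force
qed

lemma euler_nonneg: "0 \<le> euler n k i"
  using euler_invariant by blast

lemma euler_mass: "capped_mass n 1 (euler n k) \<le> M"
  using euler_invariant by blast

lemma euler_le: "euler n k i \<le> M"
proof (cases "i \<in> {1..n}")
  case True
  then have "euler n k i \<le> capped_mass n 1 (euler n k)"
    by (intro le_capped_mass_1 euler_nonneg) auto
  then show ?thesis using euler_mass[of n k] by linarith
next
  case False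
  then show ?thesis using euler_outside[of i n k] M_nonneg by simp
qed

lemma capped_mass_nonneg: "0 \<le> capped_mass n N (euler n k)"
  unfolding capped_mass_def by (intro sum_nonneg mult_nonneg_nonneg euler_nonneg) auto

lemma capped_mass_step:
  assumes "1 \<le> N"
  shows "capped_mass n N (euler n (Suc k)) + step_size n * (real N / 2) * (theta_tail n N (euler n k))\<^sup>2
    \<le> capped_mass n N (euler n k)"
proof -
  have "step_size n * capped_mass n N (rate n (euler n k)) \<le> step_size n * (- (real N / 2) * (theta_tail n N (euler n k))\<^sup>2)"
    using step_size_pos[of n] assms by (intro mult_left_mono capped_mass_dissipation euler_nonneg) auto
  then show ?thesis
    unfolding capped_mass_euler_Suc by (simp add: algebra_simps)
qed

lemma capped_mass_telescope:
  assumes N: "1 \<le> N"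
  shows "capped_mass n N (euler n k) + step_size n * (real N / 2) * (\<Sum>l<k. (theta_tail n N (euler n l))\<^sup>2)
    \<le> capped_mass n N (euler n 0)"
proof (induction k)
  case (Suc k)
  then show ?case
    using capped_mass_step[OF N, of n k] by (simp add: distrib_left)
qed simp

text \<open>
  This is \<open>2/N\<close> times the initial value of the functional \<open>capped_mass\<close> without truncation,
  and it bounds the time integral of \<open>theta_tail n N\<close> squared for every \<open>n\<close>.
\<close>

definition tail_bound :: "nat \<Rightarrow> real" where
  "tail_bound N = 2 * (\<Sum>n. (real (min (Suc n) N) / real N) * \<omega>0 (Suc n))"

lemma tail_bound_aux:
  shows "real (min i N) / real N * \<omega>0 (Suc n) \<le> \<omega>0 (Suc n)"
    and "0 \<le> real (min i N) / real N * \<omega>0 (Suc n)"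
proof -
  have "real (min i N) / real N \<le> 1" by (cases "N = 0") (auto simp: divide_simps)
  then show "real (min i N) / real N * \<omega>0 (Suc n) \<le> \<omega>0 (Suc n)"
    using mult_right_mono[of "real (min i N) / real N" 1 "\<omega>0 (Suc n)"] init_nonneg[of "Suc n"] by simp
  show "0 \<le> real (min i N) / real N * \<omega>0 (Suc n)"
    using init_nonneg[of "Suc n"] by auto
qed

lemma tail_bound_summable: "summable (\<lambda>n. (real (min (Suc n) N) / real N) * \<omega>0 (Suc n))"
  by (rule summable_comparison_test'[OF init_summable, of 0])
     (metis abs_of_nonneg real_norm_def tail_bound_aux)

lemma tail_bound_nonneg: "0 \<le> tail_bound N"
  unfolding tail_bound_def by (intro mult_nonneg_nonneg suminf_nonneg tail_bound_summable tail_bound_aux) auto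

text \<open>
  Each summand is eventually a constant over \<open>N\<close>, and all are dominated by the summable initial
  datum, so Tannery's theorem applies.
\<close>

lemma tail_bound_tendsto_0: "tail_bound \<longlonglongrightarrow> 0"
proof -
  have "(\<lambda>N. \<Sum>n. (real (min (Suc n) N) / real N) * \<omega>0 (Suc n)) \<longlonglongrightarrow> (\<Sum>n::nat. 0)"
  proof (rule conjunct2[OF conjunct2[OF tannerys_theorem]])
    show "(\<lambda>N. (real (min (Suc n) N) / real N) * \<omega>0 (Suc n)) \<longlonglongrightarrow> 0" for n
    proof -
      have "(\<lambda>N. (real (Suc n) * \<omega>0 (Suc n)) / real N) \<longlonglongrightarrow> 0"
        by (rule lim_const_over_n)
      moreover have "\<forall>\<^sub>F N in sequentially. (real (Suc n) * \<omega>0 (Suc n)) / real N = (real (min (Suc n) N) / real N) * \<omega>0 (Suc n)"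
        using eventually_ge_at_top[of "Suc n"] by eventually_elim (simp add: min_def)
      ultimately show ?thesis by (rule Lim_transform_eventually)
    qed
    show "\<forall>\<^sub>F (k,N) in sequentially \<times>\<^sub>F sequentially. norm ((real (min (Suc k) N) / real N) * \<omega>0 (Suc k)) \<le> \<omega>0 (Suc k)"
      by (intro always_eventually allI) (metis (no_types, lifting) abs_of_nonneg case_prod_beta real_norm_def tail_bound_aux)
  qed (use init_summable in auto)
  from tendsto_mult_left[OF this, of 2] show ?thesis
    unfolding tail_bound_def by simp
qed

lemma capped_mass_init: "1 \<le> N \<Longrightarrow> capped_mass n N (euler n 0) \<le> (real N / 2) * tail_bound N"
proof -
  assume N: "1 \<le> N"
  have "capped_mass n N (euler n 0) = (\<Sum>i=1..n. real (min i N) * \<omega>0 i)"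
    unfolding capped_mass_def by (intro sum.cong) auto
  also have "\<dots> = (\<Sum>k<n. real (min (Suc k) N) * \<omega>0 (Suc k))"
    by (simp add: sum.atLeast1_atMost_eq)
  also have "\<dots> = real N * (\<Sum>k<n. (real (min (Suc k) N) / real N) * \<omega>0 (Suc k))"
    using N by (simp add: sum_distrib_left)
  also have "\<dots> \<le> real N * (\<Sum>n. (real (min (Suc n) N) / real N) * \<omega>0 (Suc n))"
    by (intro mult_left_mono sum_le_suminf tail_bound_summable tail_bound_aux) auto
  finally show ?thesis by (simp add: tail_bound_def)
qed

lemma theta_tail_l2:
  assumes N: "1 \<le> N"
  shows "step_size n * (\<Sum>l<k. (theta_tail n N (euler n l))\<^sup>2) \<le> tail_bound N"
proof -
  have "(real N / 2) * (step_size n * (\<Sum>l<k. (theta_tail n N (euler n l))\<^sup>2)) \<le> (real N / 2) * tail_bound N"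
    using capped_mass_telescope[OF N, of n k] capped_mass_init[OF N, of n] capped_mass_nonneg[of n N k]
    by (simp add: mult_ac)
  then show ?thesis using N by simp
qed

text \<open>
  The Cauchy-Schwarz inequality in time: the square root of the length of the time interval is what
  gives Hoelder continuity, and the factor \<open>tail_bound N\<close> is what makes tails negligible.
\<close>

lemma theta_tail_l1:
  assumes N: "1 \<le> N" and ab: "a \<le> b"
  shows "step_size n * (\<Sum>l=a..<b. theta_tail n N (euler n l)) \<le> sqrt (real (b - a) * step_size n * tail_bound N)"
proof (rule real_le_rsqrt)
  have "(\<Sum>l=a..<b. theta_tail n N (euler n l))\<^sup>2 \<le> (\<Sum>l=a..<b. (theta_tail n N (euler n l))\<^sup>2) * real (b - a)"
    using sum_squared_le_sum_of_squares[of "\<lambda>l. theta_tail n N (euler n l)" "{a..<b}"] by simp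
  also have "\<dots> \<le> (\<Sum>l<b. (theta_tail n N (euler n l))\<^sup>2) * real (b - a)"
    by (intro mult_right_mono sum_mono2) auto
  finally have "(step_size n)\<^sup>2 * (\<Sum>l=a..<b. theta_tail n N (euler n l))\<^sup>2
      \<le> (step_size n)\<^sup>2 * ((\<Sum>l<b. (theta_tail n N (euler n l))\<^sup>2) * real (b - a))"
    by (intro mult_left_mono) auto
  also have "\<dots> = (real (b - a) * step_size n) * (step_size n * (\<Sum>l<b. (theta_tail n N (euler n l))\<^sup>2))"
    by (simp add: power2_eq_square)
  also have "\<dots> \<le> (real (b - a) * step_size n) * tail_bound N"
    using step_size_pos[of n] by (intro mult_left_mono theta_tail_l2 N) auto
  finally show "(step_size n * (\<Sum>l=a..<b. theta_tail n N (euler n l)))\<^sup>2 \<le> real (b - a) * step_size n * tail_bound N"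
    by (simp add: power_mult_distrib)
qed

text \<open>
  Below the truncation \<open>min i (n + 1)\<close> equals \<open>i\<close>, so the mass is one of the decreasing functionals.
  It is therefore smallest at the last step, while the sum of its squares over all steps is
  controlled by the dissipation. This is where \<open>\<theta>\<^sub>i \<ge> B i\<close> enters.
\<close>

lemma euler_first_moment:
  "real k * step_size n * (B * (\<Sum>i=1..n. real i * euler n k i))\<^sup>2 \<le> tail_bound 1"
proof -
  let ?m = "\<lambda>l. \<Sum>i=1..n. real i * euler n l i"
  have m: "?m l = capped_mass n (Suc n) (euler n l)" for l
    unfolding capped_mass_def by (intro sum.cong) (auto simp: min_def)
  have "?m (Suc l) \<le> ?m l" for l
  proof -
    have "0 \<le> step_size n * (real (Suc n) / 2) * (theta_tail n (Suc n) (euler n l))\<^sup>2"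
      using step_size_pos[of n] by simp
    then show ?thesis
      unfolding m using capped_mass_step[of "Suc n" n l] by linarith
  qed
  then have anti: "?m k \<le> ?m l" if "l \<le> k" for l
    using that by (rule lift_Suc_antimono_le)
  have "B * ?m l \<le> theta_tail n 1 (euler n l)" for l
    unfolding theta_tail_def sum_distrib_left
    by (intro sum_mono) (use theta_lower in \<open>auto simp flip: mult.assoc intro!: mult_right_mono euler_nonneg\<close>)
  then have le: "B * ?m k \<le> theta_tail n 1 (euler n l)" if "l \<le> k" for l
    using anti[OF that] B_pos by (meson less_imp_le mult_left_mono order_trans)
  have ge0: "0 \<le> B * ?m k"
    using B_pos by (intro mult_nonneg_nonneg sum_nonneg euler_nonneg) auto
  have "real k * (B * ?m k)\<^sup>2 = (\<Sum>l<k. (B * ?m k)\<^sup>2)" by simp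
  also have "\<dots> \<le> (\<Sum>l<k. (theta_tail n 1 (euler n l))\<^sup>2)"
    using le ge0 by (intro sum_mono power_mono) auto
  finally have "step_size n * (real k * (B * ?m k)\<^sup>2) \<le> step_size n * (\<Sum>l<k. (theta_tail n 1 (euler n l))\<^sup>2)"
    using step_size_pos[of n] by (intro mult_left_mono) auto
  also have "\<dots> \<le> tail_bound 1" by (rule theta_tail_l2) simp
  finally show ?thesis by (simp add: mult_ac)
qed

end

section \<open>Step functions and compactness\<close>

text \<open>
  Riemann sums of the Euler scheme are integrals of step functions, which makes the convergence
  theorems for integrals available.
\<close>

lemma step_function_integral:
  fixes g :: "nat \<Rightarrow> real"
  assumes h: "0 < h"
  shows "integrable lborel (\<lambda>s. indicator {0..<real m * h} s * g (nat \<lfloor>s / h\<rfloor>))"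
    and "(LINT s|lborel. indicator {0..<real m * h} s * g (nat \<lfloor>s / h\<rfloor>)) = h * (\<Sum>k<m. g k)"
proof -
  have eq: "indicator {0..<real m * h} s * g (nat \<lfloor>s / h\<rfloor>)
      = (\<Sum>k<m. g k * indicator {real k * h..<real k * h + h} s)" for s
  proof (induction m)
    case (Suc m)
    have "nat \<lfloor>s / h\<rfloor> = m" if "s \<in> {real m * h..<real m * h + h}"
    proof -
      have "real m \<le> s / h" "s / h < real m + 1"
        using that h by (auto simp: field_simps)
      then have "\<lfloor>s / h\<rfloor> = int m" by (intro floor_unique) auto
      then show ?thesis by simp
    qed
    moreover have "0 \<le> real m * h" using h by simp
    then have "indicator {0..<real (Suc m) * h} s
        = (indicator {0..<real m * h} s + indicator {real m * h..<real m * h + h} s :: real)"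
      using h by (auto simp: indicator_def algebra_simps intro: order_trans[of 0 "h * real m"])
    ultimately show ?case
      using Suc by (auto simp: indicator_def split: if_splits)
  qed simp
  show "integrable lborel (\<lambda>s. indicator {0..<real m * h} s * g (nat \<lfloor>s / h\<rfloor>))"
    unfolding eq by (intro Bochner_Integration.integrable_sum integrable_mult_right) (use h in auto)
  have "(LINT s|lborel. indicator {0..<real m * h} s * g (nat \<lfloor>s / h\<rfloor>))
      = (\<Sum>k<m. LINT s|lborel. g k * indicator {real k * h..<real k * h + h} s)"
    unfolding eq by (intro Bochner_Integration.integral_sum integrable_mult_right) (use h in auto)
  also have "\<dots> = (\<Sum>k<m. g k * h)"
    using h by (intro sum.cong) auto
  finally show "(LINT s|lborel. indicator {0..<real m * h} s * g (nat \<lfloor>s / h\<rfloor>)) = h * (\<Sum>k<m. g k)"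
    by (simp add: sum_distrib_left mult.commute)
qed

text \<open>
  An Arzela-Ascoli theorem for countably many components and discontinuous functions whose
  oscillation at scales above \<open>h n\<close> is controlled: a diagonal subsequence converges at rational
  times, equicontinuity carries this to all times, and the defect \<open>h n\<close> is gone in the limit.
\<close>

lemma asymptotically_equicontinuous_subsequence:
  fixes f :: "nat \<Rightarrow> 'i::countable \<Rightarrow> real \<Rightarrow> real"
  assumes bound: "\<And>n i t. \<bar>f n i t\<bar> \<le> M"
    and h: "h \<longlonglongrightarrow> 0"
    and equi: "\<And>i e. 0 < e \<Longrightarrow> \<exists>d>0. \<forall>n. \<forall>s\<ge>0. \<forall>t\<ge>0.
                 \<bar>t - s\<bar> + h n < d \<longrightarrow> \<bar>f n i t - f n i s\<bar> < e"
  obtains r g where "strict_mono r" "\<And>i t. 0 \<le> t \<Longrightarrow> (\<lambda>n. f (r n) i t) \<longlonglongrightarrow> g i t"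
    "\<And>i. continuous_on {0..} (g i)"
proof -
  obtain r where r: "strict_mono (r::nat\<Rightarrow>nat)"
    and conv: "\<And>p. p \<in> UNIV \<times> \<rat> \<Longrightarrow> \<exists>l. (\<lambda>n. f (r n) (fst p) (snd p)) \<longlonglongrightarrow> l"
    by (rule function_convergent_subsequence[of "UNIV \<times> \<rat>" "\<lambda>n p. f n (fst p) (snd p)" M])
       (use bound countable_rat in auto)
  have hr: "(\<lambda>n. h (r n)) \<longlonglongrightarrow> 0"
    using LIMSEQ_subseq_LIMSEQ[OF h r] by (simp add: o_def)
  have "Cauchy (\<lambda>n. f (r n) i t)" if t: "0 \<le> t" for i t
  proof (rule metric_CauchyI)
    fix e :: real assume e: "0 < e"
    then obtain d where d: "d > 0" and
      close: "\<And>n s t. 0 \<le> s \<Longrightarrow> 0 \<le> t \<Longrightarrow> \<bar>t - s\<bar> + h n < d \<Longrightarrow> \<bar>f n i t - f n i s\<bar> < e / 3"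
      using equi[of "e / 3" i] by auto
    \<comment> \<open>Half of \<open>d\<close> is for the distance from \<open>t\<close> to \<open>q\<close>, the other half for the defect \<open>h\<close>.\<close>
    obtain q where q: "q \<in> \<rat>" "t < q" "q < t + d / 2"
      using Rats_dense_in_real[of t "t + d / 2"] d by auto
    have "Cauchy (\<lambda>n. f (r n) i q)"
      using conv[of "(i, q)"] q LIMSEQ_imp_Cauchy by auto
    then obtain N1 where N1: "\<And>m n. m \<ge> N1 \<Longrightarrow> n \<ge> N1 \<Longrightarrow> dist (f (r m) i q) (f (r n) i q) < e / 3"
      using e unfolding Cauchy_def by (metis divide_pos_pos zero_less_numeral)
    obtain N2 where N2: "\<And>n. n \<ge> N2 \<Longrightarrow> h (r n) < d / 2"
      using order_tendstoD(2)[OF hr, of "d / 2"] d by (auto simp: eventually_sequentially)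
    have near: "\<bar>f (r n) i q - f (r n) i t\<bar> < e / 3" if "n \<ge> N2" for n
      using close[of t q "r n"] N2[OF that] q t by auto
    have "dist (f (r m) i t) (f (r n) i t) < e" if "m \<ge> max N1 N2" "n \<ge> max N1 N2" for m n
    proof -
      have "dist (f (r m) i q) (f (r n) i q) < e / 3" using N1 that by simp
      moreover have "\<bar>f (r m) i q - f (r m) i t\<bar> < e / 3" "\<bar>f (r n) i q - f (r n) i t\<bar> < e / 3"
        using near that by simp_all
      ultimately show ?thesis unfolding dist_real_def by linarith
    qed
    then show "\<exists>N. \<forall>m\<ge>N. \<forall>n\<ge>N. dist (f (r m) i t) (f (r n) i t) < e" by blast
  qed
  then have lim: "(\<lambda>n. f (r n) i t) \<longlonglongrightarrow> lim (\<lambda>n. f (r n) i t)" if "0 \<le> t" for i t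
    using that Cauchy_convergent convergent_LIMSEQ_iff by blast
  have "continuous_on {0..} (\<lambda>t. lim (\<lambda>n. f (r n) i t))" for i
  proof (rule continuous_onI)
    fix s e :: real assume s: "s \<in> {0..}" and e: "0 < e"
    then obtain d where d: "d > 0" and
      close: "\<And>n s t. 0 \<le> s \<Longrightarrow> 0 \<le> t \<Longrightarrow> \<bar>t - s\<bar> + h n < d \<Longrightarrow> \<bar>f n i t - f n i s\<bar> < e"
      using equi[of e i] by auto
    have "dist (lim (\<lambda>n. f (r n) i t)) (lim (\<lambda>n. f (r n) i s)) \<le> e"
      if t: "t \<in> {0..}" and ts: "dist t s < d" for t
    proof -
      obtain N where N: "\<And>n. n \<ge> N \<Longrightarrow> h (r n) < d - \<bar>t - s\<bar>"
        using order_tendstoD(2)[OF hr, of "d - \<bar>t - s\<bar>"] ts by (auto simp: eventually_sequentially dist_real_def)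
      show ?thesis
      proof (rule Lim_bounded)
        show "(\<lambda>n. dist (f (r n) i t) (f (r n) i s)) \<longlonglongrightarrow> dist (lim (\<lambda>n. f (r n) i t)) (lim (\<lambda>n. f (r n) i s))"
          using s t by (intro tendsto_dist lim) auto
        show "\<forall>n\<ge>N. dist (f (r n) i t) (f (r n) i s) \<le> e"
        proof (intro allI impI)
          fix n assume "n \<ge> N"
          then have "\<bar>t - s\<bar> + h (r n) < d" using N[of n] by linarith
          then show "dist (f (r n) i t) (f (r n) i s) \<le> e"
            using close[of s t "r n"] s t by (simp add: dist_real_def)
        qed
      qed
    qed
    then show "\<exists>d>0. \<forall>t\<in>{0..}. dist t s < d \<longrightarrow> dist (lim (\<lambda>n. f (r n) i t)) (lim (\<lambda>n. f (r n) i s)) \<le> e"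
      using d by blast
  qed
  then show ?thesis using that[OF r lim] by blast
qed

context coag_data
begin

lemma step_size_tendsto_0: "step_size \<longlonglongrightarrow> 0"
proof (rule tendsto_sandwich)
  show "\<forall>\<^sub>F n in sequentially. 0 \<le> step_size n"
    using step_size_pos by (auto simp: less_imp_le)
  show "\<forall>\<^sub>F n in sequentially. step_size n \<le> 1 / real (Suc n)"
    using step_size_le by (auto simp: add_ac)
  show "(\<lambda>n. 1 / real (Suc n)) \<longlonglongrightarrow> 0"
    using LIMSEQ_inverse_real_of_nat by (simp add: inverse_eq_divide)
qed simp

text \<open>
  A bound for the two flux terms of \<open>rate\<close> by replacing each component by its upper bound \<open>M\<close>.
\<close>

definition rate_bound :: "nat \<Rightarrow> real" where
  "rate_bound i = M * (\<Sum>j=1..i - 1. real j * \<Lambda> (i - 1) j * M) + M * (\<Sum>j=1..i. real j * \<Lambda> i j * M)"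

lemma rate_bound_nonneg: "1 \<le> i \<Longrightarrow> 0 \<le> rate_bound i"
  unfolding rate_bound_def
  by (intro add_nonneg_nonneg mult_nonneg_nonneg sum_nonneg Lam_nonneg M_nonneg) auto

lemma rate_le:
  assumes i: "1 \<le> i" and y: "\<And>j. 0 \<le> y j" "\<And>j. y j \<le> M"
  shows "\<bar>rate n y i\<bar> \<le> rate_bound i + K * \<theta> i * M * theta_tail n 1 y"
proof -
  have g: "growth y k \<le> M * (\<Sum>j=1..k. real j * \<Lambda> k j * M)" for k
    unfolding growth_def
    by (intro mult_mono sum_mono mult_left_mono sum_nonneg mult_nonneg_nonneg y Lam_nonneg M_nonneg) auto
  have "loss n y i \<le> (\<Sum>j=i..n. K * \<theta> i * \<theta> j * M * y j)"
    unfolding loss_def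
    by (intro sum_mono mult_mono mult_nonneg_nonneg Lam_upper Lam_nonneg y order_refl K_nonneg theta_nonneg M_nonneg) (use i in auto)
  also have "\<dots> \<le> (\<Sum>j=1..n. K * \<theta> i * \<theta> j * M * y j)"
    using i by (intro sum_mono2 mult_nonneg_nonneg y K_nonneg theta_nonneg M_nonneg) auto
  also have "\<dots> = K * \<theta> i * M * theta_tail n 1 y"
    by (simp add: theta_tail_def sum_distrib_left mult_ac)
  finally have l: "loss n y i \<le> K * \<theta> i * M * theta_tail n 1 y" .
  have l0: "0 \<le> loss n y i"
    unfolding loss_def using i by (intro sum_nonneg mult_nonneg_nonneg y Lam_nonneg) auto
  have g0: "0 \<le> growth y k" for k by (intro growth_nonneg y)
  show ?thesis
    using g[of i] g[of "i - 1"] l l0 g0[of i] g0[of "i - 1"] unfolding rate_def rate_bound_def by linarith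
qed

lemma euler_diff:
  assumes "a \<le> b" "i \<in> {1..n}"
  shows "euler n b i - euler n a i = step_size n * (\<Sum>l=a..<b. rate n (euler n l) i)"
  using assms(1)
proof (induction b rule: dec_induct)
  case (step b)
  have "euler n (Suc b) i - euler n a i = (euler n b i - euler n a i) + step_size n * rate n (euler n b) i"
    using assms(2) by simp
  also have "\<dots> = step_size n * (\<Sum>l=a..<Suc b. rate n (euler n l) i)"
    unfolding step.IH using step.hyps by (simp add: distrib_left)
  finally show ?case .
qed simp

lemma euler_hoelder:
  assumes i: "1 \<le> i" and ab: "a \<le> b"
  shows "\<bar>euler n b i - euler n a i\<bar> \<le> rate_bound i * (real (b - a) * step_size n)
     + K * \<theta> i * M * sqrt (real (b - a) * step_size n * tail_bound 1)"
proof (cases "i \<le> n")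
  case True
  have "\<bar>euler n b i - euler n a i\<bar> = step_size n * \<bar>\<Sum>l=a..<b. rate n (euler n l) i\<bar>"
    using euler_diff[OF ab, of i n] i True step_size_pos[of n] by (simp add: abs_mult)
  also have "\<dots> \<le> step_size n * (\<Sum>l=a..<b. rate_bound i + K * \<theta> i * M * theta_tail n 1 (euler n l))"
    using step_size_pos[of n] i
    by (intro mult_left_mono order_trans[OF sum_abs] sum_mono rate_le euler_nonneg euler_le) auto
  also have "\<dots> = rate_bound i * (real (b - a) * step_size n)
      + K * \<theta> i * M * (step_size n * (\<Sum>l=a..<b. theta_tail n 1 (euler n l)))"
    by (simp add: sum.distrib sum_distrib_left algebra_simps)
  also have "\<dots> \<le> rate_bound i * (real (b - a) * step_size n)
     + K * \<theta> i * M * sqrt (real (b - a) * step_size n * tail_bound 1)"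
    using i ab by (intro add_left_mono mult_left_mono theta_tail_l1 mult_nonneg_nonneg K_nonneg theta_nonneg M_nonneg) auto
  finally show ?thesis .
next
  case False
  have "0 \<le> rate_bound i * (real (b - a) * step_size n)
     + K * \<theta> i * M * sqrt (real (b - a) * step_size n * tail_bound 1)"
    using i step_size_pos[of n]
    by (intro add_nonneg_nonneg mult_nonneg_nonneg rate_bound_nonneg K_nonneg theta_nonneg M_nonneg real_sqrt_ge_zero tail_bound_nonneg) auto
  then show ?thesis using False by (simp add: euler_outside)
qed

definition index :: "nat \<Rightarrow> real \<Rightarrow> nat" where
  "index n t = nat \<lfloor>t / step_size n\<rfloor>"

definition approx :: "nat \<Rightarrow> nat \<Rightarrow> real \<Rightarrow> real" where
  "approx n i t = euler n (index n t) i"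

lemma index_bounds:
  assumes "0 \<le> t"
  shows index_le: "real (index n t) * step_size n \<le> t"
    and less_index: "t < real (index n t) * step_size n + step_size n"
proof -
  have h: "0 < step_size n" by (rule step_size_pos)
  have "0 \<le> t / step_size n" using assms h by simp
  then have "real (index n t) = of_int \<lfloor>t / step_size n\<rfloor>" by (simp add: index_def)
  then have "real (index n t) \<le> t / step_size n" "t / step_size n < real (index n t) + 1" by linarith+
  then show "real (index n t) * step_size n \<le> t" "t < real (index n t) * step_size n + step_size n"
    using h by (auto simp: field_simps)
qed

lemma index_mono: "s \<le> t \<Longrightarrow> index n s \<le> index n t"
  unfolding index_def using step_size_pos[of n]
  by (intro nat_mono floor_mono divide_right_mono) auto

lemma index_tendsto:
  assumes "0 \<le> t"
  shows "(\<lambda>n. real (index n t) * step_size n) \<longlonglongrightarrow> t"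
proof (rule tendsto_sandwich)
  show "\<forall>\<^sub>F n in sequentially. t - step_size n \<le> real (index n t) * step_size n"
    using less_index[OF assms] by (auto simp: less_imp_le algebra_simps)
  show "\<forall>\<^sub>F n in sequentially. real (index n t) * step_size n \<le> t"
    using index_le[OF assms] by auto
  show "(\<lambda>n. t - step_size n) \<longlonglongrightarrow> t"
    using tendsto_diff[OF tendsto_const step_size_tendsto_0, of t] by simp
qed simp

lemma approx_hoelder:
  assumes i: "1 \<le> i" and s: "0 \<le> s" and t: "0 \<le> t" and d: "\<bar>t - s\<bar> + step_size n \<le> d"
  shows "\<bar>approx n i t - approx n i s\<bar> \<le> rate_bound i * d + K * \<theta> i * M * sqrt (d * tail_bound 1)"
proof -
  have *: "\<bar>approx n i t - approx n i s\<bar> \<le> rate_bound i * d + K * \<theta> i * M * sqrt (d * tail_bound 1)"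
    if "0 \<le> s" "s \<le> t" "t - s + step_size n \<le> d" for s t
  proof -
    have le: "index n s \<le> index n t" by (rule index_mono) fact
    have "real (index n t - index n s) * step_size n
        = real (index n t) * step_size n - real (index n s) * step_size n"
      using le by (simp add: of_nat_diff algebra_simps)
    also have "\<dots> \<le> d"
      using index_le[of t n] less_index[of s n] that by linarith
    finally have D: "real (index n t - index n s) * step_size n \<le> d" .
    have "\<bar>approx n i t - approx n i s\<bar> \<le> rate_bound i * (real (index n t - index n s) * step_size n)
     + K * \<theta> i * M * sqrt (real (index n t - index n s) * step_size n * tail_bound 1)"
      unfolding approx_def by (rule euler_hoelder[OF i le])
    also have "\<dots> \<le> rate_bound i * d + K * \<theta> i * M * sqrt (d * tail_bound 1)"
      by (intro add_mono mult_left_mono real_sqrt_le_mono mult_right_mono D rate_bound_nonneg i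
          tail_bound_nonneg mult_nonneg_nonneg K_nonneg theta_nonneg M_nonneg)
    finally show ?thesis .
  qed
  show ?thesis
    using *[of s t] *[of t s] s t d by (cases "s \<le> t") (auto simp: abs_minus_commute)
qed

lemma approx_equicontinuous:
  assumes i: "1 \<le> i" and e: "0 < e"
  shows "\<exists>d>0. \<forall>n. \<forall>s\<ge>0. \<forall>t\<ge>0. \<bar>t - s\<bar> + step_size n < d \<longrightarrow> \<bar>approx n i t - approx n i s\<bar> < e"
proof -
  let ?m = "\<lambda>d. rate_bound i * d + K * \<theta> i * M * sqrt (d * tail_bound 1)"
  have "isCont ?m 0" by (intro continuous_intros)
  then have "?m \<midarrow>0\<rightarrow> 0" by (simp add: isCont_def)
  then obtain d where d: "d > 0" "\<And>x. x \<noteq> 0 \<Longrightarrow> \<bar>x\<bar> < d \<Longrightarrow> \<bar>?m x\<bar> < e"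
    unfolding LIM_def using e by (auto simp: dist_real_def)
  have "\<bar>approx n i t - approx n i s\<bar> < e"
    if "0 \<le> s" "0 \<le> t" "\<bar>t - s\<bar> + step_size n < d" for n s t
  proof -
    have "0 < \<bar>t - s\<bar> + step_size n" using step_size_pos[of n] by simp
    then have "\<bar>?m (\<bar>t - s\<bar> + step_size n)\<bar> < e" using that(3) by (intro d(2)) linarith+
    moreover have "\<bar>approx n i t - approx n i s\<bar> \<le> ?m (\<bar>t - s\<bar> + step_size n)"
      using that by (intro approx_hoelder i) auto
    ultimately show ?thesis by linarith
  qed
  then show ?thesis using d(1) by blast
qed

lemma approx_nonneg: "0 \<le> approx n i t" and approx_le: "approx n i t \<le> M"
  by (auto simp: approx_def euler_nonneg euler_le)

text \<open>
  The approximations are constant for negative times, so convergence on \<open>{0..}\<close> extends to the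
  whole line. This makes the limit a measurable function on the line.
\<close>

lemma approx_limit_exists:
  obtains r \<omega> where "strict_mono (r::nat\<Rightarrow>nat)" "\<And>i t. (\<lambda>n. approx (r n) i t) \<longlonglongrightarrow> \<omega> i t"
    "\<And>i. continuous_on {0..} (\<omega> i)"
proof -
  have eq: "approx n i (max 0 t) = approx n i t" for n i t
    using step_size_pos[of n] by (auto simp: approx_def index_def max_def divide_nonpos_pos)
  have ex: "\<exists>d>0. \<forall>n. \<forall>s\<ge>0. \<forall>t\<ge>0. \<bar>t - s\<bar> + step_size n < d \<longrightarrow> \<bar>approx n i t - approx n i s\<bar> < e"
    if "0 < e" for i e
  proof (cases "i = 0")
    case True
    then have "approx n i t = 0" for n t by (simp add: approx_def euler_outside)
    then show ?thesis using that by (intro exI[of _ 1]) auto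
  qed (use approx_equicontinuous[of i e] that in auto)
  have b: "\<bar>approx n i t\<bar> \<le> M" for n i t
    using approx_nonneg[of n i t] approx_le[of n i t] by simp
  obtain r g where r: "strict_mono r" and g: "\<And>i t. 0 \<le> t \<Longrightarrow> (\<lambda>n. approx (r n) i t) \<longlonglongrightarrow> g i t"
    and c: "\<And>i. continuous_on {0..} (g i)"
    by (rule asymptotically_equicontinuous_subsequence[of approx M step_size, OF b step_size_tendsto_0 ex]) auto
  show ?thesis
  proof (rule that[OF r])
    show "(\<lambda>n. approx (r n) i t) \<longlonglongrightarrow> g i (max 0 t)" for i t
      using g[of "max 0 t" i] by (simp add: eq)
    show "continuous_on {0..} (\<lambda>t. g i (max 0 t))" for i
      using c[of i] by (rule continuous_on_eq) (simp add: max_def)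
  qed
qed

end

section \<open>The limit solves the equation\<close>

locale coag_limit = coag_data +
  fixes r :: "nat \<Rightarrow> nat" and \<omega> :: "nat \<Rightarrow> real \<Rightarrow> real"
  assumes r: "strict_mono r"
    and approx_tendsto: "\<And>i t. (\<lambda>n. approx (r n) i t) \<longlonglongrightarrow> \<omega> i t"
begin

lemma lim_nonneg: "0 \<le> \<omega> i t"
  by (rule LIMSEQ_le_const[OF approx_tendsto]) (auto intro: approx_nonneg)

lemma lim_le: "\<omega> i t \<le> M"
  by (rule LIMSEQ_le_const2[OF approx_tendsto]) (auto intro: approx_le)

lemma eventually_r_ge: "\<forall>\<^sub>F n in sequentially. m \<le> r n"
  using filterlim_subseq[OF r] by (simp add: filterlim_at_top)

lemma lim_measurable [measurable]: "\<omega> i \<in> borel_measurable borel"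
proof (rule borel_measurable_LIMSEQ_real)
  show "approx (r n) i \<in> borel_measurable borel" for n
    unfolding approx_def index_def by measurable
qed (rule approx_tendsto)

lemma lim_mass: "(\<Sum>i=1..m. \<omega> i t) \<le> M"
proof (rule tendsto_upperbound)
  show "(\<lambda>n. \<Sum>i=1..m. approx (r n) i t) \<longlonglongrightarrow> (\<Sum>i=1..m. \<omega> i t)"
    by (intro tendsto_sum approx_tendsto)
  show "\<forall>\<^sub>F n in sequentially. (\<Sum>i=1..m. approx (r n) i t) \<le> M"
    using eventually_r_ge[of m]
  proof eventually_elim
    case (elim n)
    have "(\<Sum>i=1..m. approx (r n) i t) \<le> (\<Sum>i=1..r n. approx (r n) i t)"
      using elim by (intro sum_mono2 approx_nonneg) auto
    also have "\<dots> = capped_mass (r n) 1 (euler (r n) (index (r n) t))"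
      unfolding capped_mass_def approx_def by (intro sum.cong) (auto simp: min_def)
    also have "\<dots> \<le> M" by (rule euler_mass)
    finally show ?case .
  qed
qed simp

lemma lim_first_moment:
  assumes t: "0 < t"
  shows "(\<Sum>i=1..m. real i * \<omega> i t) \<le> sqrt (tail_bound 1 / t) / B"
proof -
  let ?S = "\<lambda>y. B * (\<Sum>i=1..m. real i * y i)"
  have "t * (?S (\<lambda>i. \<omega> i t))\<^sup>2 \<le> tail_bound 1"
  proof (rule tendsto_upperbound)
    show "(\<lambda>n. real (index (r n) t) * step_size (r n) * (?S (\<lambda>i. approx (r n) i t))\<^sup>2)
        \<longlonglongrightarrow> t * (?S (\<lambda>i. \<omega> i t))\<^sup>2"
      using t by (intro tendsto_intros approx_tendsto
          LIMSEQ_subseq_LIMSEQ[OF index_tendsto r, unfolded o_def]) auto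
    show "\<forall>\<^sub>F n in sequentially. real (index (r n) t) * step_size (r n) * (?S (\<lambda>i. approx (r n) i t))\<^sup>2 \<le> tail_bound 1"
      using eventually_r_ge[of m]
    proof eventually_elim
      case (elim n)
      have "?S (\<lambda>i. approx (r n) i t) \<le> B * (\<Sum>i=1..r n. real i * euler (r n) (index (r n) t) i)"
        unfolding approx_def using elim B_pos
        by (intro mult_left_mono sum_mono2 mult_nonneg_nonneg euler_nonneg) auto
      moreover have "0 \<le> ?S (\<lambda>i. approx (r n) i t)"
        using B_pos by (intro mult_nonneg_nonneg sum_nonneg approx_nonneg) auto
      ultimately have "(?S (\<lambda>i. approx (r n) i t))\<^sup>2 \<le> (B * (\<Sum>i=1..r n. real i * euler (r n) (index (r n) t) i))\<^sup>2"
        by (rule power_mono)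
      then have "real (index (r n) t) * step_size (r n) * (?S (\<lambda>i. approx (r n) i t))\<^sup>2
          \<le> real (index (r n) t) * step_size (r n) * (B * (\<Sum>i=1..r n. real i * euler (r n) (index (r n) t) i))\<^sup>2"
        using step_size_pos[of "r n"] by (intro mult_left_mono) auto
      also have "\<dots> \<le> tail_bound 1" by (rule euler_first_moment)
      finally show ?case .
    qed
  qed simp
  then have "(?S (\<lambda>i. \<omega> i t))\<^sup>2 \<le> tail_bound 1 / t"
    using t by (simp add: field_simps)
  then have "?S (\<lambda>i. \<omega> i t) \<le> sqrt (tail_bound 1 / t)"
    by (rule real_le_rsqrt)
  then show ?thesis using B_pos by (simp add: field_simps)
qed

lemma cutoff_tendsto:
  assumes t: "0 \<le> t"
  shows "(\<lambda>n. indicator {0..<real (index (r n) t) * step_size (r n)} s :: real) \<longlonglongrightarrow> indicator {0..<t} s"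
proof (cases "s < t")
  case True
  have "\<forall>\<^sub>F n in sequentially. s < real (index (r n) t) * step_size (r n)"
    using LIMSEQ_subseq_LIMSEQ[OF index_tendsto[OF t] r] True
    unfolding o_def by (rule order_tendstoD(1))
  then have "\<forall>\<^sub>F n in sequentially. indicator {0..<t} s = (indicator {0..<real (index (r n) t) * step_size (r n)} s :: real)"
    by eventually_elim (use True in \<open>auto simp: indicator_def\<close>)
  then show ?thesis by (rule Lim_transform_eventually[OF tendsto_const])
next
  case False
  have "(indicator {0..<real (index (r n) t) * step_size (r n)} s :: real) = indicator {0..<t} s" for n
    using False index_le[OF t, of "r n"] by (auto simp: indicator_def)
  then show ?thesis by simp
qed

text \<open>
  Applied to functionals of finitely many components, which converge along the approximations.
  The integrals run up to the last grid point not after \<open>t\<close>, which is why the indicator functions vary with \<open>n\<close>.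
\<close>

lemma euler_sum_tendsto:
  assumes t: "0 \<le> t"
    and lim: "\<And>s. (\<lambda>n. \<Phi> (\<lambda>i. approx (r n) i s)) \<longlonglongrightarrow> \<Phi> (\<lambda>i. \<omega> i s)"
    and bound: "\<And>y. (\<And>i. 0 \<le> y i) \<Longrightarrow> (\<And>i. y i \<le> M) \<Longrightarrow> \<bar>\<Phi> y\<bar> \<le> C"
  shows "integrable lborel (\<lambda>s. indicator {0..<t} s * \<Phi> (\<lambda>i. \<omega> i s))"
    and "(\<lambda>n. step_size (r n) * (\<Sum>l<index (r n) t. \<Phi> (euler (r n) l)))
          \<longlonglongrightarrow> (LINT s|lborel. indicator {0..<t} s * \<Phi> (\<lambda>i. \<omega> i s))"
proof -
  let ?f = "\<lambda>n s. indicator {0..<real (index (r n) t) * step_size (r n)} s * \<Phi> (\<lambda>i. approx (r n) i s)"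
  have int: "integrable lborel (?f n)"
    and eq: "(LINT s|lborel. ?f n s) = step_size (r n) * (\<Sum>l<index (r n) t. \<Phi> (euler (r n) l))" for n
    using step_function_integral[OF step_size_pos, of "index (r n) t" "r n" "\<lambda>k. \<Phi> (euler (r n) k)"]
    by (simp_all add: approx_def index_def)
  have f: "(\<lambda>n. ?f n s) \<longlonglongrightarrow> indicator {0..<t} s * \<Phi> (\<lambda>i. \<omega> i s)" for s
    by (intro tendsto_mult cutoff_tendsto t lim)
  have meas: "?f n \<in> borel_measurable lborel" for n
    using int by (rule borel_measurable_integrable)
  have w: "integrable lborel (\<lambda>s. indicator {0..<t} s * C)"
    by (intro integrable_mult_left) (use t in auto)
  have le: "norm (?f n s) \<le> indicator {0..<t} s * C" for n s
  proof -
    have "\<bar>\<Phi> (\<lambda>i. approx (r n) i s)\<bar> \<le> C"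
      by (rule bound) (auto intro: approx_nonneg approx_le)
    then show ?thesis
      using index_le[OF t, of "r n"] by (auto simp: indicator_def abs_mult)
  qed
  have limm: "(\<lambda>s. indicator {0..<t} s * \<Phi> (\<lambda>i. \<omega> i s)) \<in> borel_measurable lborel"
    using f meas by (rule borel_measurable_LIMSEQ_real)
  show "integrable lborel (\<lambda>s. indicator {0..<t} s * \<Phi> (\<lambda>i. \<omega> i s))"
    by (rule integrable_dominated_convergence[where s = ?f, OF limm _ w]) (use f le meas in auto)
  show "(\<lambda>n. step_size (r n) * (\<Sum>l<index (r n) t. \<Phi> (euler (r n) l)))
          \<longlonglongrightarrow> (LINT s|lborel. indicator {0..<t} s * \<Phi> (\<lambda>i. \<omega> i s))"
    unfolding eq[symmetric]
    by (rule integral_dominated_convergence[where s = ?f, OF limm _ w]) (use f le meas in auto)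
qed

lemma theta_tail_l1_index:
  assumes "0 \<le> t" "1 \<le> N"
  shows "step_size n * (\<Sum>l<index n t. theta_tail n N (euler n l)) \<le> sqrt (t * tail_bound N)"
proof -
  have "step_size n * (\<Sum>l<index n t. theta_tail n N (euler n l)) \<le> sqrt (real (index n t) * step_size n * tail_bound N)"
    using theta_tail_l1[OF assms(2), of 0 "index n t" n] by (simp add: lessThan_atLeast0)
  also have "\<dots> \<le> sqrt (t * tail_bound N)"
    by (intro real_sqrt_le_mono mult_right_mono index_le assms tail_bound_nonneg)
  finally show ?thesis .
qed

text \<open>
  The loss series is cut off at a fixed \<open>N\<close> before the limit, so that only finitely many components
  occur. What is cut off from the Euler scheme is bounded by \<open>theta_tail\<close> and hence small
  uniformly in \<open>n\<close>.
\<close>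

lemma lim_approximate_equation:
  assumes i: "1 \<le> i" and t: "0 \<le> t" and N: "i \<le> N"
  shows "\<bar>\<omega> i t - \<omega>0 i - (LINT s|lborel. indicator {0..<t} s * rate N (\<lambda>j. \<omega> j s) i)\<bar>
      \<le> K * \<theta> i * M * sqrt (t * tail_bound (Suc N))"
proof -
  let ?C = "rate_bound i + K * \<theta> i * M * (\<Sum>j=1..N. \<theta> j * M)"
  have lim: "(\<lambda>n. rate N (\<lambda>j. approx (r n) j s) i) \<longlonglongrightarrow> rate N (\<lambda>j. \<omega> j s) i" for s
    unfolding rate_def growth_def loss_def by (intro tendsto_intros approx_tendsto)
  have bound: "\<bar>rate N y i\<bar> \<le> ?C" if y: "\<And>j. 0 \<le> y j" "\<And>j. y j \<le> M" for y
  proof -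
    have "theta_tail N 1 y \<le> (\<Sum>j=1..N. \<theta> j * M)"
      unfolding theta_tail_def by (intro sum_mono mult_left_mono y theta_nonneg) auto
    then have "K * \<theta> i * M * theta_tail N 1 y \<le> K * \<theta> i * M * (\<Sum>j=1..N. \<theta> j * M)"
      by (intro mult_left_mono mult_nonneg_nonneg K_nonneg theta_nonneg i M_nonneg)
    then show ?thesis using rate_le[of i y N, OF i y] by linarith
  qed
  note * = euler_sum_tendsto[of t "\<lambda>y. rate N y i", OF t lim bound]
  show "\<bar>\<omega> i t - \<omega>0 i - (LINT s|lborel. indicator {0..<t} s * rate N (\<lambda>j. \<omega> j s) i)\<bar>
      \<le> K * \<theta> i * M * sqrt (t * tail_bound (Suc N))"
  proof (rule tendsto_upperbound)
    show "(\<lambda>n. \<bar>approx (r n) i t - \<omega>0 i - step_size (r n) * (\<Sum>l<index (r n) t. rate N (euler (r n) l) i)\<bar>)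
      \<longlonglongrightarrow> \<bar>\<omega> i t - \<omega>0 i - (LINT s|lborel. indicator {0..<t} s * rate N (\<lambda>j. \<omega> j s) i)\<bar>"
      by (intro tendsto_intros approx_tendsto *)
    show "\<forall>\<^sub>F n in sequentially.
       \<bar>approx (r n) i t - \<omega>0 i - step_size (r n) * (\<Sum>l<index (r n) t. rate N (euler (r n) l) i)\<bar>
        \<le> K * \<theta> i * M * sqrt (t * tail_bound (Suc N))"
      using eventually_r_ge[of N]
    proof eventually_elim
      case (elim n)
      let ?n = "r n" and ?k = "index (r n) t"
      have split: "rate N y i - rate ?n y i = (\<Sum>j=Suc N..?n. \<Lambda> i j * y i * y j)" for y
      proof -
        have "{i..?n} = {i..N} \<union> {Suc N..?n}" using N elim by auto
        then have "loss ?n y i = loss N y i + (\<Sum>j=Suc N..?n. \<Lambda> i j * y i * y j)"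
          unfolding loss_def by (simp add: sum.union_disjoint)
        then show ?thesis by (simp add: rate_def)
      qed
      have tail: "\<bar>rate ?n (euler ?n l) i - rate N (euler ?n l) i\<bar> \<le> K * \<theta> i * M * theta_tail ?n (Suc N) (euler ?n l)" for l
      proof -
        let ?y = "euler ?n l"
        have "(\<Sum>j=Suc N..?n. \<Lambda> i j * ?y i * ?y j) \<le> (\<Sum>j=Suc N..?n. K * \<theta> i * \<theta> j * M * ?y j)"
          by (intro sum_mono mult_mono mult_nonneg_nonneg Lam_upper Lam_nonneg euler_nonneg euler_le
              order_refl K_nonneg theta_nonneg M_nonneg) (use i in auto)
        also have "\<dots> = K * \<theta> i * M * theta_tail ?n (Suc N) ?y"
          by (simp add: theta_tail_def sum_distrib_left mult_ac)
        finally have "(\<Sum>j=Suc N..?n. \<Lambda> i j * ?y i * ?y j) \<le> K * \<theta> i * M * theta_tail ?n (Suc N) ?y" .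
        moreover have "0 \<le> (\<Sum>j=Suc N..?n. \<Lambda> i j * ?y i * ?y j)"
          using i by (intro sum_nonneg mult_nonneg_nonneg Lam_nonneg euler_nonneg) auto
        ultimately show ?thesis using split[of ?y] by linarith
      qed
      have "approx ?n i t - \<omega>0 i = step_size ?n * (\<Sum>l<?k. rate ?n (euler ?n l) i)"
        using euler_diff[of 0 ?k i ?n] i N elim by (simp add: approx_def lessThan_atLeast0)
      then have "\<bar>approx ?n i t - \<omega>0 i - step_size ?n * (\<Sum>l<?k. rate N (euler ?n l) i)\<bar>
          = step_size ?n * \<bar>\<Sum>l<?k. rate ?n (euler ?n l) i - rate N (euler ?n l) i\<bar>"
        using step_size_pos[of ?n] by (simp add: sum_subtractf abs_mult flip: right_diff_distrib)
      also have "\<dots> \<le> step_size ?n * (\<Sum>l<?k. K * \<theta> i * M * theta_tail ?n (Suc N) (euler ?n l))"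
        using step_size_pos[of ?n]
        by (intro mult_left_mono order_trans[OF sum_abs] sum_mono tail) auto
      also have "\<dots> = K * \<theta> i * M * (step_size ?n * (\<Sum>l<?k. theta_tail ?n (Suc N) (euler ?n l)))"
        by (simp add: sum_distrib_left mult_ac)
      also have "\<dots> \<le> K * \<theta> i * M * sqrt (t * tail_bound (Suc N))"
        by (intro mult_left_mono theta_tail_l1_index t mult_nonneg_nonneg K_nonneg theta_nonneg i M_nonneg) auto
      finally show ?case .
    qed
  qed simp
qed

definition weight :: "real \<Rightarrow> real" where
  "weight s = (\<Sum>n. \<theta> (Suc n) * \<omega> (Suc n) s)"

text \<open>
  The bound does not depend on \<open>m\<close>, so monotone convergence will give integrability of \<open>weight\<close>.
\<close>

lemma weight_partial_integral:
  assumes t: "0 \<le> t"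
  shows "integrable lborel (\<lambda>s. indicator {0..<t} s * (\<Sum>j=1..m. \<theta> j * \<omega> j s))"
    and "(LINT s|lborel. indicator {0..<t} s * (\<Sum>j=1..m. \<theta> j * \<omega> j s)) \<le> sqrt (t * tail_bound 1)"
proof -
  have lim: "(\<lambda>n. \<Sum>j=1..m. \<theta> j * approx (r n) j s) \<longlonglongrightarrow> (\<Sum>j=1..m. \<theta> j * \<omega> j s)" for s
    by (intro tendsto_intros approx_tendsto)
  have bound: "\<bar>\<Sum>j=1..m. \<theta> j * y j\<bar> \<le> (\<Sum>j=1..m. \<theta> j * M)"
    if y: "\<And>j. 0 \<le> y j" "\<And>j. y j \<le> M" for y
  proof -
    have "0 \<le> (\<Sum>j=1..m. \<theta> j * y j)" "(\<Sum>j=1..m. \<theta> j * y j) \<le> (\<Sum>j=1..m. \<theta> j * M)"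
      by (intro sum_nonneg sum_mono mult_nonneg_nonneg mult_left_mono y theta_nonneg; simp)+
    then show ?thesis by simp
  qed
  note * = euler_sum_tendsto[of t "\<lambda>y. \<Sum>j=1..m. \<theta> j * y j", OF t lim bound]
  show "integrable lborel (\<lambda>s. indicator {0..<t} s * (\<Sum>j=1..m. \<theta> j * \<omega> j s))"
    by (rule *)
  show "(LINT s|lborel. indicator {0..<t} s * (\<Sum>j=1..m. \<theta> j * \<omega> j s)) \<le> sqrt (t * tail_bound 1)"
  proof (rule tendsto_upperbound[OF *(2)])
    show "\<forall>\<^sub>F n in sequentially. step_size (r n) * (\<Sum>l<index (r n) t. \<Sum>j=1..m. \<theta> j * euler (r n) l j) \<le> sqrt (t * tail_bound 1)"
      using eventually_r_ge[of m]
    proof eventually_elim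
      case (elim n)
      have "step_size (r n) * (\<Sum>l<index (r n) t. \<Sum>j=1..m. \<theta> j * euler (r n) l j)
          \<le> step_size (r n) * (\<Sum>l<index (r n) t. theta_tail (r n) 1 (euler (r n) l))"
        unfolding theta_tail_def using step_size_pos[of "r n"] elim
        by (intro mult_left_mono sum_mono sum_mono2 mult_nonneg_nonneg theta_nonneg euler_nonneg) auto
      also have "\<dots> \<le> sqrt (t * tail_bound 1)"
        by (intro theta_tail_l1_index t) auto
      finally show ?case .
    qed
  qed auto
qed

lemma weight_integrable:
  assumes t: "0 \<le> t"
  shows weight_summable_AE: "AE s in lborel. s \<in> {0..<t} \<longrightarrow> summable (\<lambda>n. \<theta> (Suc n) * \<omega> (Suc n) s)"
    and integrable_weight: "integrable lborel (\<lambda>s. indicator {0..<t} s * weight s)"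
proof -
  let ?v = "\<lambda>n s. indicator {0..<t} s * (\<theta> (Suc n) * \<omega> (Suc n) s)"
  have v0: "0 \<le> ?v n s" for n s
    by (intro mult_nonneg_nonneg theta_nonneg lim_nonneg) auto
  have vm [measurable]: "?v n \<in> borel_measurable lborel" for n by measurable
  have "(\<integral>\<^sup>+ s. (\<Sum>n. ennreal (?v n s)) \<partial>lborel) = (\<Sum>n. \<integral>\<^sup>+ s. ennreal (?v n s) \<partial>lborel)"
    by (rule nn_integral_suminf) measurable
  also have "\<dots> \<le> ennreal (sqrt (t * tail_bound 1))"
  proof (rule suminf_le_const)
    show "(\<Sum>n<m. \<integral>\<^sup>+ s. ennreal (?v n s) \<partial>lborel) \<le> ennreal (sqrt (t * tail_bound 1))" for m
    proof -
      have eq: "(\<Sum>n<m. ?v n s) = indicator {0..<t} s * (\<Sum>j=1..m. \<theta> j * \<omega> j s)" for s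
        by (simp add: sum.atLeast1_atMost_eq sum_distrib_left)
      have "(\<Sum>n<m. \<integral>\<^sup>+ s. ennreal (?v n s) \<partial>lborel) = (\<integral>\<^sup>+ s. (\<Sum>n<m. ennreal (?v n s)) \<partial>lborel)"
        by (rule nn_integral_sum[symmetric]) measurable
      also have "\<dots> = (\<integral>\<^sup>+ s. ennreal (\<Sum>n<m. ?v n s) \<partial>lborel)"
        by (intro nn_integral_cong sum_ennreal v0)
      also have "\<dots> = ennreal (LINT s|lborel. (\<Sum>n<m. ?v n s))"
        using weight_partial_integral(1)[OF t, of m]
        by (intro nn_integral_eq_integral AE_I2 sum_nonneg v0) (simp add: eq)
      also have "\<dots> \<le> ennreal (sqrt (t * tail_bound 1))"
        unfolding eq by (intro ennreal_leI weight_partial_integral t)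
      finally show ?thesis .
    qed
  qed auto
  finally have fin: "(\<integral>\<^sup>+ s. (\<Sum>n. ennreal (?v n s)) \<partial>lborel) \<le> ennreal (sqrt (t * tail_bound 1))" .
  then have "AE s in lborel. (\<Sum>n. ennreal (?v n s)) \<noteq> \<infinity>"
    by (intro nn_integral_PInf_AE) (auto simp: top_unique)
  then have sm: "AE s in lborel. summable (\<lambda>n. ?v n s)"
    by eventually_elim (intro summable_suminf_not_top v0, simp)
  then show "AE s in lborel. s \<in> {0..<t} \<longrightarrow> summable (\<lambda>n. \<theta> (Suc n) * \<omega> (Suc n) s)"
    by eventually_elim auto
  have w: "(\<Sum>n. ?v n s) = indicator {0..<t} s * weight s" for s
    by (cases "s \<in> {0..<t}") (auto simp: weight_def)
  have "integrable lborel (\<lambda>s. \<Sum>n. ?v n s)"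
  proof (rule integrableI_bounded)
    have "(\<integral>\<^sup>+ s. ennreal (norm (\<Sum>n. ?v n s)) \<partial>lborel) = (\<integral>\<^sup>+ s. (\<Sum>n. ennreal (?v n s)) \<partial>lborel)"
    proof (rule nn_integral_cong_AE)
      show "AE s in lborel. ennreal (norm (\<Sum>n. ?v n s)) = (\<Sum>n. ennreal (?v n s))"
        using sm
      proof eventually_elim
        case (elim s)
        have "(\<Sum>n. ennreal (?v n s)) = ennreal (\<Sum>n. ?v n s)"
          by (rule suminf_ennreal2[OF v0 elim])
        moreover have "0 \<le> (\<Sum>n. ?v n s)" by (rule suminf_nonneg[OF elim v0])
        ultimately show ?case by simp
      qed
    qed
    also have "\<dots> < \<infinity>" using fin by (auto simp: less_top top_unique intro: le_less_trans)
    finally show "(\<integral>\<^sup>+ s. ennreal (norm (\<Sum>n. ?v n s)) \<partial>lborel) < \<infinity>" .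
  qed measurable
  then show "integrable lborel (\<lambda>s. indicator {0..<t} s * weight s)"
    unfolding w .
qed

lemma kernel_series_summable:
  assumes i: "1 \<le> i" and s: "summable (\<lambda>n. \<theta> (Suc n) * \<omega> (Suc n) s)"
  shows "summable (\<lambda>n. \<Lambda> i (Suc n) * \<omega> (Suc n) s)"
    and "(\<Sum>n. \<Lambda> i (Suc n) * \<omega> (Suc n) s) \<le> K * \<theta> i * weight s"
    and "0 \<le> (\<Sum>n. \<Lambda> i (Suc n) * \<omega> (Suc n) s)"
proof -
  have le: "\<Lambda> i (Suc n) * \<omega> (Suc n) s \<le> K * \<theta> i * (\<theta> (Suc n) * \<omega> (Suc n) s)" for n
    using mult_right_mono[OF Lam_upper[OF i, of "Suc n"] lim_nonneg[of "Suc n" s]] by (simp add: mult_ac)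
  have ge: "0 \<le> \<Lambda> i (Suc n) * \<omega> (Suc n) s" for n
    using i by (intro mult_nonneg_nonneg Lam_nonneg lim_nonneg) auto
  have s': "summable (\<lambda>n. K * \<theta> i * (\<theta> (Suc n) * \<omega> (Suc n) s))"
    using s by (rule summable_mult)
  show *: "summable (\<lambda>n. \<Lambda> i (Suc n) * \<omega> (Suc n) s)"
    by (rule summable_comparison_test'[OF s', of 0]) (metis abs_of_nonneg ge le real_norm_def)
  show "(\<Sum>n. \<Lambda> i (Suc n) * \<omega> (Suc n) s) \<le> K * \<theta> i * weight s"
    unfolding weight_def suminf_mult[OF s, symmetric] by (rule suminf_le[OF le * s'])
  show "0 \<le> (\<Sum>n. \<Lambda> i (Suc n) * \<omega> (Suc n) s)"
    by (rule suminf_nonneg[OF * ge])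
qed

lemma rate_tendsto_SD_rhs:
  assumes i: "1 \<le> i" and s: "summable (\<lambda>n. \<theta> (Suc n) * \<omega> (Suc n) s)"
  shows "(\<lambda>N. rate N (\<lambda>j. \<omega> j s) i) \<longlonglongrightarrow> SD_rhs \<Lambda> (\<lambda>j. \<omega> j s) i"
proof -
  have "summable (\<lambda>n. \<Lambda> i (Suc (n + (i - 1))) * \<omega> (Suc (n + (i - 1))) s)"
    using kernel_series_summable(1)[OF i s] by (rule summable_ignore_initial_segment)
  then have "summable (\<lambda>n. \<omega> i s * (\<Lambda> i (Suc (n + (i - 1))) * \<omega> (Suc (n + (i - 1))) s))"
    by (rule summable_mult)
  also have "(\<lambda>n. \<omega> i s * (\<Lambda> i (Suc (n + (i - 1))) * \<omega> (Suc (n + (i - 1))) s))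
      = (\<lambda>n. \<Lambda> i (i + n) * \<omega> i s * \<omega> (i + n) s)"
    using i by (auto simp: fun_eq_iff add.commute)
  finally have "(\<lambda>m. \<Sum>n<m. \<Lambda> i (i + n) * \<omega> i s * \<omega> (i + n) s)
      \<longlonglongrightarrow> (\<Sum>n. \<Lambda> i (i + n) * \<omega> i s * \<omega> (i + n) s)"
    by (rule summable_LIMSEQ)
  moreover have "(\<Sum>n<m. \<Lambda> i (i + n) * \<omega> i s * \<omega> (i + n) s) = loss (m + (i - 1)) (\<lambda>j. \<omega> j s) i" for m
    unfolding loss_def
    by (rule sum.reindex_bij_witness[of _ "\<lambda>j. j - i" "\<lambda>n. i + n"]) (use i in auto)
  ultimately have "(\<lambda>m. loss (m + (i - 1)) (\<lambda>j. \<omega> j s) i) \<longlonglongrightarrow> (\<Sum>n. \<Lambda> i (i + n) * \<omega> i s * \<omega> (i + n) s)"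
    by simp
  then have "(\<lambda>N. loss N (\<lambda>j. \<omega> j s) i) \<longlonglongrightarrow> (\<Sum>n. \<Lambda> i (i + n) * \<omega> i s * \<omega> (i + n) s)"
    by (rule LIMSEQ_offset)
  then have "(\<lambda>N. rate N (\<lambda>j. \<omega> j s) i) \<longlonglongrightarrow> growth (\<lambda>j. \<omega> j s) (i - 1) - growth (\<lambda>j. \<omega> j s) i
      - (\<Sum>n. \<Lambda> i (i + n) * \<omega> i s * \<omega> (i + n) s)"
    unfolding rate_def by (intro tendsto_intros)
  also have "growth (\<lambda>j. \<omega> j s) (i - 1) - growth (\<lambda>j. \<omega> j s) i
      - (\<Sum>n. \<Lambda> i (i + n) * \<omega> i s * \<omega> (i + n) s) = SD_rhs \<Lambda> (\<lambda>j. \<omega> j s) i"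
    by (auto simp: SD_rhs_def growth_def)
  finally show ?thesis .
qed

lemma SD_rhs_measurable: "(\<lambda>s. SD_rhs \<Lambda> (\<lambda>j. \<omega> j s) i) \<in> borel_measurable borel"
  unfolding SD_rhs_def by measurable

text \<open>
  The limit of the integrals with cut-off \<open>N\<close> is computed in two ways: by dominated convergence with a
  constant plus a multiple of \<open>weight\<close> as majorant, and by the error bound that vanishes with \<open>tail_bound N\<close>.
\<close>

lemma lim_equation:
  assumes i: "1 \<le> i" and t: "0 \<le> t"
  shows "\<omega> i t = \<omega>0 i + (LINT s|lborel. indicator {0..<t} s * SD_rhs \<Lambda> (\<lambda>j. \<omega> j s) i)"
proof -
  let ?I = "\<lambda>N. LINT s|lborel. indicator {0..<t} s * rate N (\<lambda>j. \<omega> j s) i"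
  have 1: "?I \<longlonglongrightarrow> (LINT s|lborel. indicator {0..<t} s * SD_rhs \<Lambda> (\<lambda>j. \<omega> j s) i)"
  proof (rule integral_dominated_convergence)
    show "(\<lambda>s. indicator {0..<t} s * SD_rhs \<Lambda> (\<lambda>j. \<omega> j s) i) \<in> borel_measurable lborel"
      using SD_rhs_measurable[of i] by measurable
    show "(\<lambda>s. indicator {0..<t} s * rate N (\<lambda>j. \<omega> j s) i) \<in> borel_measurable lborel" for N
      unfolding rate_def growth_def loss_def by measurable
    show "integrable lborel (\<lambda>s. indicator {0..<t} s * rate_bound i + K * \<theta> i * M * (indicator {0..<t} s * weight s))"
      by (intro Bochner_Integration.integrable_add integrable_mult_right integrable_mult_left integrable_weight t) (use t in auto)
    show "AE s in lborel. (\<lambda>N. indicator {0..<t} s * rate N (\<lambda>j. \<omega> j s) i)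
        \<longlonglongrightarrow> indicator {0..<t} s * SD_rhs \<Lambda> (\<lambda>j. \<omega> j s) i"
      using weight_summable_AE[OF t]
    proof eventually_elim
      case (elim s)
      then show ?case
        using rate_tendsto_SD_rhs[OF i, of s] by (cases "s \<in> {0..<t}") auto
    qed
    show "AE s in lborel. norm (indicator {0..<t} s * rate N (\<lambda>j. \<omega> j s) i)
        \<le> indicator {0..<t} s * rate_bound i + K * \<theta> i * M * (indicator {0..<t} s * weight s)" for N
      using weight_summable_AE[OF t]
    proof eventually_elim
      case (elim s)
      show ?case
      proof (cases "s \<in> {0..<t}")
        case True
        have "theta_tail N 1 (\<lambda>j. \<omega> j s) = (\<Sum>n<N. \<theta> (Suc n) * \<omega> (Suc n) s)"
          by (simp add: theta_tail_def sum.atLeast1_atMost_eq)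
        also have "\<dots> \<le> weight s"
          unfolding weight_def
          by (intro sum_le_suminf mult_nonneg_nonneg theta_nonneg lim_nonneg) (use elim True in auto)
        finally have "K * \<theta> i * M * theta_tail N 1 (\<lambda>j. \<omega> j s) \<le> K * \<theta> i * M * weight s"
          by (intro mult_left_mono mult_nonneg_nonneg K_nonneg theta_nonneg i M_nonneg)
        then show ?thesis
          using rate_le[OF i, of "\<lambda>j. \<omega> j s" N] lim_nonneg lim_le True by (force simp: abs_mult)
      qed auto
    qed
  qed
  have 2: "?I \<longlonglongrightarrow> \<omega> i t - \<omega>0 i"
  proof (rule LIM_zero_cancel, rule Lim_null_comparison)
    show "\<forall>\<^sub>F N in sequentially. norm (?I N - (\<omega> i t - \<omega>0 i)) \<le> K * \<theta> i * M * sqrt (t * tail_bound (Suc N))"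
      using eventually_ge_at_top[of i]
    proof eventually_elim
      case (elim N)
      then show ?case
        using lim_approximate_equation[OF i t elim] by (simp add: abs_minus_commute)
    qed
    have "(\<lambda>N. K * \<theta> i * M * sqrt (t * tail_bound (Suc N))) \<longlonglongrightarrow> K * \<theta> i * M * sqrt (t * 0)"
      by (intro tendsto_intros LIMSEQ_Suc tail_bound_tendsto_0)
    then show "(\<lambda>N. K * \<theta> i * M * sqrt (t * tail_bound (Suc N))) \<longlonglongrightarrow> 0" by simp
  qed
  from LIMSEQ_unique[OF 1 2] show ?thesis by simp
qed

lemma lim_SD_solution:
  assumes cont: "\<And>i. continuous_on {0..} (\<omega> i)"
  shows "SD_solution \<Lambda> \<omega>0 \<infinity> \<omega>"
proof -
  have *: "(AE s in lebesgue. 0 < s \<and> s < t \<longrightarrow> summable (\<lambda>n. \<Lambda> i (Suc n) * \<omega> (Suc n) s)) \<and>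
        set_integrable lebesgue {0<..<t} (\<lambda>s. \<Sum>n. \<Lambda> i (Suc n) * \<omega> (Suc n) s) \<and>
        \<omega> i t = \<omega>0 i + (LINT s:{0..t}|lebesgue. SD_rhs \<Lambda> (\<lambda>j. \<omega> j s) i)"
    if i: "1 \<le> i" and t: "0 < t" for i t
  proof (intro conjI)
    have t0: "0 \<le> t" using t by simp
    have "AE s in lborel. 0 < s \<and> s < t \<longrightarrow> summable (\<lambda>n. \<Lambda> i (Suc n) * \<omega> (Suc n) s)"
      using weight_summable_AE[OF t0] by eventually_elim (use kernel_series_summable(1)[OF i] in auto)
    then show "AE s in lebesgue. 0 < s \<and> s < t \<longrightarrow> summable (\<lambda>n. \<Lambda> i (Suc n) * \<omega> (Suc n) s)"
      by (rule AE_completion)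
    let ?f = "\<lambda>s. indicator {0<..<t} s * (\<Sum>n. \<Lambda> i (Suc n) * \<omega> (Suc n) s)"
    have fm: "?f \<in> borel_measurable lborel" by measurable
    have "integrable lborel ?f"
    proof (rule Bochner_Integration.integrable_bound[OF _ fm])
      show "integrable lborel (\<lambda>s. K * \<theta> i * (indicator {0..<t} s * weight s))"
        by (intro integrable_mult_right integrable_weight t0)
      show "AE s in lborel. norm (?f s) \<le> norm (K * \<theta> i * (indicator {0..<t} s * weight s))"
        using weight_summable_AE[OF t0]
      proof eventually_elim
        case (elim s)
        show ?case
        proof (cases "s \<in> {0<..<t}")
          case True
          then have "summable (\<lambda>n. \<theta> (Suc n) * \<omega> (Suc n) s)" using elim by simp
          from kernel_series_summable(2,3)[OF i this] True show ?thesis by simp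
        qed auto
      qed
    qed
    then have "integrable lebesgue ?f"
      using integrable_completion[OF fm] by simp
    then show "set_integrable lebesgue {0<..<t} (\<lambda>s. \<Sum>n. \<Lambda> i (Suc n) * \<omega> (Suc n) s)"
      by (simp add: set_integrable_def)
    have "(LINT s:{0..t}|lebesgue. SD_rhs \<Lambda> (\<lambda>j. \<omega> j s) i)
        = (LINT s|lborel. indicator {0..t} s *\<^sub>R SD_rhs \<Lambda> (\<lambda>j. \<omega> j s) i)"
      unfolding set_lebesgue_integral_def using SD_rhs_measurable[of i] by (intro integral_completion) measurable
    also have "\<dots> = (LINT s|lborel. indicator {0..<t} s * SD_rhs \<Lambda> (\<lambda>j. \<omega> j s) i)"
    proof (rule integral_cong_AE)
      show "AE s in lborel. indicator {0..t} s *\<^sub>R SD_rhs \<Lambda> (\<lambda>j. \<omega> j s) i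
          = indicator {0..<t} s * SD_rhs \<Lambda> (\<lambda>j. \<omega> j s) i"
        using AE_lborel_singleton[of t] by eventually_elim (auto simp: indicator_def)
    qed (use SD_rhs_measurable[of i] in measurable)
    finally show "\<omega> i t = \<omega>0 i + (LINT s:{0..t}|lebesgue. SD_rhs \<Lambda> (\<lambda>j. \<omega> j s) i)"
      using lim_equation[OF i t0] by simp
  qed
  have cont': "continuous_on {t. 0 \<le> t \<and> ereal t < \<infinity>} (\<omega> i)" for i
    using cont[of i] by (rule continuous_on_subset) auto
  show ?thesis
    unfolding SD_solution_def
    by (intro conjI allI impI cont' lim_nonneg *[THEN conjunct1]
        *[THEN conjunct2, THEN conjunct1] *[THEN conjunct2, THEN conjunct2]) simp_all
qed

lemma lim_Ynorm_le:
  assumes "\<And>m. (\<Sum>i=1..m. real i powr p * \<omega> i t) \<le> c"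
  shows "Ynorm p (\<lambda>i. \<omega> i t) < \<infinity>"
proof -
  have "Ynorm p (\<lambda>i. \<omega> i t) \<le> ennreal c"
    unfolding Ynorm_def
  proof (rule suminf_le_const)
    fix m
    have "(\<Sum>n<m. ennreal (real (Suc n) powr p * \<bar>\<omega> (Suc n) t\<bar>)) = ennreal (\<Sum>n<m. real (Suc n) powr p * \<omega> (Suc n) t)"
      using lim_nonneg by (subst sum_ennreal) (auto intro: mult_nonneg_nonneg)
    also have "\<dots> \<le> ennreal c"
      using assms[of m] by (intro ennreal_leI) (simp add: sum.atLeast1_atMost_eq)
    finally show "(\<Sum>n<m. ennreal (real (Suc n) powr p * \<bar>\<omega> (Suc n) t\<bar>)) \<le> ennreal c" .
  qed auto
  then show ?thesis by (rule le_less_trans) simp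
qed

lemma lim_Yplus: "(\<lambda>i. \<omega> i t) \<in> Yplus 0"
proof -
  have "(\<Sum>i=1..m. real i powr 0 * \<omega> i t) \<le> M" for m
  proof -
    have "(\<Sum>i=1..m. real i powr 0 * \<omega> i t) = (\<Sum>i=1..m. \<omega> i t)"
      by (intro sum.cong) auto
    then show ?thesis using lim_mass by simp
  qed
  then have "Ynorm 0 (\<lambda>i. \<omega> i t) < \<infinity>" by (rule lim_Ynorm_le)
  then show ?thesis using lim_nonneg by (auto simp: Yplus_def Y_def)
qed

lemma lim_Y1:
  assumes "0 < t" shows "Ynorm 1 (\<lambda>i. \<omega> i t) < \<infinity>"
  by (rule lim_Ynorm_le) (use lim_first_moment[OF assms] in simp)

end

section \<open>Existence for summable initial data\<close>

theorem theorem2p2: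
  fixes \<Lambda> \<kappa> :: "nat \<Rightarrow> nat \<Rightarrow> real"
    and \<theta> \<omega>in :: "nat \<Rightarrow> real"
    and A B :: real
  assumes "coag_kernel \<Lambda>"
    and "\<forall>i\<ge>1. 0 \<le> \<theta> i"
    and "\<forall>i\<ge>1. \<forall>j\<ge>1. 0 \<le> \<kappa> i j"
    and "\<forall>i\<ge>1. \<forall>j\<ge>1. \<Lambda> i j = \<theta> i * \<theta> j + \<kappa> i j"
    and "(INF i\<in>{1..}. \<theta> i / real i) = B" and "B > 0"
    and "A \<ge> 0"
    and "\<forall>i\<ge>1. \<forall>j\<ge>1. \<kappa> i j \<le> A * \<theta> i * \<theta> j"
    and "\<omega>in \<in> Yplus 0"
  shows "\<exists>\<omega>. SD_solution \<Lambda> \<omega>in \<infinity> \<omega>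
           \<and> (\<forall>t\<ge>0. (\<lambda>i. \<omega> i t) \<in> Yplus 0)
           \<and> (\<forall>t>0. Ynorm 1 (\<lambda>i. \<omega> i t) < \<infinity>)"
proof -
  have B_le: "B * real i \<le> \<theta> i" if "1 \<le> i" for i
  proof -
    have "B \<le> \<theta> i / real i"
      unfolding assms(5)[symmetric]
      by (rule cINF_lower, rule bdd_belowI2[where m = 0]) (use assms(2) that in auto)
    then show ?thesis using that by (simp add: field_simps)
  qed
  have pos: "0 \<le> \<omega>in i" if "1 \<le> i" for i
    using assms(9) that by (auto simp: Yplus_def)
  have "summable (\<lambda>n. \<omega>in (Suc n))"
  proof (rule summable_suminf_not_top)
    have "Ynorm 0 \<omega>in = (\<Sum>n. ennreal (\<omega>in (Suc n)))"
      unfolding Ynorm_def using pos by (intro suminf_cong) auto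
    then show "(\<Sum>n. ennreal (\<omega>in (Suc n))) \<noteq> top"
      using assms(9) by (auto simp: Yplus_def Y_def)
  qed (use pos in auto)
  then interpret coag_data \<Lambda> \<theta> \<omega>in "1 + A" B
    using assms B_le pos by unfold_locales (auto simp: coag_kernel_def algebra_simps)
  obtain r \<omega> where "strict_mono (r::nat\<Rightarrow>nat)" "\<And>i t. (\<lambda>n. approx (r n) i t) \<longlonglongrightarrow> \<omega> i t"
    and cont: "\<And>i. continuous_on {0..} (\<omega> i)"
    using approx_limit_exists by metis
  then interpret coag_limit \<Lambda> \<theta> \<omega>in "1 + A" B r \<omega>
    by unfold_locales
  show ?thesis
    using lim_SD_solution[OF cont] lim_Yplus lim_Y1 by blast
qed

end
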